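(* Let $X=\mathbb{F}^n$ with $\mathbb{F}=\mathbb{R}$ or $\mathbb{C}$. The full Grassmannian $G(X)$ is an asymmetric metric space with distances given by $d(V,W)=\Theta_{V,W}$ for $V,W\in G(X)$, where $\Theta_{V,W}$ is the asymmetric angle from $V$ to $W$. That is, for all $U,V,W\in G(X)$: (i) $\Theta_{V,W}=\Theta_{W,V}=0$ if and only if $V=W$; (ii) $\Theta_{U,W}\le\Theta_{U,V}+\Theta_{V,W}$.
   Context: $X=\mathbb{F}^n$ carries an inner product $\langle\cdot,\cdot\rangle$ (Hermitian, conjugate linear in the first entry, if $\mathbb{F}=\mathbb{C}$). $G(X)$ is the set of all subspaces of $X$, of all dimensions $0,\dots,n$. The exterior algebra $\bigwedge X=\bigoplus_p\bigwedge^pX$ has the inner product with $\langle v_1\wedge\cdots\wedge v_p,w_1\wedge\cdots\wedge w_p\rangle=\det(\langle v_i,w_j\rangle)$, $\langle\kappa,\lambda\rangle=\bar\kappa\lambda$ for scalars in $\bigwedge^0X=\mathbb{F}$, and distinct grades orthogonal. A nonzero $p$-blade $A=v_1\wedge\cdots\wedge v_p$ represents the $p$-dimensional subspace $\mathrm{span}\{v_1,\dots,v_p\}$; a nonzero scalar ($0$-blade) represents $\{0\}$. For a subspace $W$, $P_W$ denotes the orthogonal projection $X\to W$ and also the orthogonal projection $\bigwedge X\to\bigwedge W$ (which extends it, with $P_W1=1$ and $P_W(A\wedge B)=P_WA\wedge P_WB$). Asymmetric angle: for $V,W\in G(X)$ and any blade $A$ representing $V$, $\Theta_{V,W}=\cos^{-1}\frac{\|P_WA\|}{\|A\|}\in[0,\frac\pi2]$.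 An asymmetric metric on a non-empty set $M$ is a function $d:M\times M\to[0,\infty]$ with $d(x,y)=d(y,x)=0\Leftrightarrow x=y$ and $d(x,z)\le d(x,y)+d(y,z)$ for all $x,y,z\in M$. *)

theory Defs
  imports
    "HOL-Analysis.Analysis"
    "Jordan_Normal_Form.Determinant"
    "Jordan_Normal_Form.Conjugate"
begin

text \<open>Everything is written for a scalar type in the sort
  \<open>{real_normed_field, conjugatable_field}\<close>; its intended members are \<open>real\<close>, where
  \<open>conjugate\<close> is the identity, and \<open>complex\<close>, where it is \<open>cnj\<close>. Subspaces and spans are
  the scalar-linear ones, \<open>vec.subspace\<close> and \<open>vec.span\<close>: over \<open>complex\<close> the constants
  \<open>subspace\<close> and \<open>span\<close> of HOL-Analysis would be real-linear.\<close>

type_synonym ('a, 'n) coord_space = "'a ^ 'n"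
type_synonym ('a, 'n) vec_form = "('a, 'n) coord_space \<Rightarrow> ('a, 'n) coord_space \<Rightarrow> 'a"

definition inner_product ::
    "('a::{real_normed_field, conjugatable_field}, 'n::{finite,linorder}) vec_form \<Rightarrow>
    bool" where
  "inner_product g \<longleftrightarrow>
     (\<forall>x y z. g x (y + z) = g x y + g x z) \<and>
     (\<forall>x c y. g x (c *s y) = c * g x y) \<and>
     (\<forall>x y. g y x = conjugate (g x y)) \<and>
     (\<forall>x. x \<noteq> 0 \<longrightarrow> (\<exists>r > 0. g x x = of_real r))"

definition full_grassmannian :: "('a::field, 'n::finite) coord_space set set" where
  "full_grassmannian = {V. vec.subspace V}"


text \<open>The exterior algebra of \<open>'a ^ 'n\<close> has basis \<open>e\<^sub>I = e\<^bsub>i1\<^esub> \<and> \<dots> \<and> e\<^bsub>ip\<^esub>\<close>, where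
  \<open>I = {i1 < \<dots> < ip}\<close> ranges over the sets of indices. A multivector is the family of its
  coordinates in this basis; the linear order on \<open>'n\<close> serves only to fix the signs.\<close>

type_synonym ('a, 'n) multivector = "'a ^ ('n set)"

definition mv_scalar :: "'a::field \<Rightarrow> ('a, 'n::finite) multivector" where
  "mv_scalar c = (\<chi> I. if I = {} then c else 0)"

definition mv_vector :: "('a::field, 'n::finite) coord_space \<Rightarrow> ('a, 'n) multivector" where
  "mv_vector v = (\<chi> I. if is_singleton I then v $ the_elem I else 0)"

text \<open>For disjoint \<open>I\<close>, \<open>J\<close> one has \<open>e\<^sub>I \<and> e\<^sub>J = shuffle_sign I J \<cdot> e\<^bsub>I \<union> J\<^esub>\<close>; otherwise
  \<open>e\<^sub>I \<and> e\<^sub>J = 0\<close>.\<close>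

definition shuffle_sign :: "'n::linorder set \<Rightarrow> 'n set \<Rightarrow> 'a::field" where
  "shuffle_sign I J = (- 1) ^ card {(i, j). i \<in> I \<and> j \<in> J \<and> j < i}"

definition wedge :: "('a::field, 'n::{finite,linorder}) multivector \<Rightarrow>
    ('a, 'n) multivector \<Rightarrow> ('a, 'n) multivector" where
  "wedge A B = (\<chi> K. \<Sum>I\<in>Pow K. shuffle_sign I (K - I) * A $ I * B $ (K - I))"

text \<open>\<open>wedge_list [v\<^sub>1, \<dots>, v\<^sub>p] = v\<^sub>1 \<and> \<dots> \<and> v\<^sub>p\<close>, with the empty product equal to 1.\<close>

definition wedge_list ::
    "('a::field, 'n::{finite,linorder}) coord_space list \<Rightarrow> ('a, 'n) multivector" where
  "wedge_list vs = foldr (\<lambda>v A. wedge (mv_vector v) A) vs (mv_scalar 1)"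

definition represents ::
    "('a::field, 'n::{finite,linorder}) multivector \<Rightarrow> ('a, 'n) coord_space set \<Rightarrow> bool" where
  "represents A V \<longleftrightarrow> A \<noteq> 0 \<and>
     ((\<exists>vs. vs \<noteq> [] \<and> A = wedge_list vs \<and> V = vec.span (set vs)) \<or>
      (\<exists>c. A = mv_scalar c \<and> V = {0}))"


definition gram_det :: "('a::field, 'n::finite) vec_form \<Rightarrow>
    ('a, 'n) coord_space list \<Rightarrow> ('a, 'n) coord_space list \<Rightarrow> 'a" where
  "gram_det g vs ws =
     Determinant.det (Matrix.mat (length vs) (length ws) (\<lambda>(i, j). g (vs ! i) (ws ! j)))"

definition basis_list :: "'n::{finite,linorder} set \<Rightarrow> ('a::field, 'n) coord_space list" where
  "basis_list I = map (\<lambda>i. axis i 1) (sorted_list_of_set I)"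

text \<open>The inner product on multivectors, conjugate linear in the first argument, induced by
  the inner product \<open>g\<close> on vectors: the rule
  \<open>\<langle>v\<^sub>1 \<and> \<dots> \<and> v\<^sub>p, w\<^sub>1 \<and> \<dots> \<and> w\<^sub>p\<rangle> = det (g v\<^sub>i w\<^sub>j)\<close>, with distinct grades orthogonal,
  gives its values on the basis \<open>e\<^sub>I\<close>, which need not be orthogonal for \<open>g\<close>, and it is
  extended sesquilinearly.\<close>

definition mv_inner :: "('a::{real_normed_field, conjugatable_field}, 'n::{finite,linorder}) vec_form \<Rightarrow>
    ('a, 'n) multivector \<Rightarrow> ('a, 'n) multivector \<Rightarrow> 'a" where
  "mv_inner g A B = (\<Sum>I\<in>UNIV. \<Sum>J\<in>UNIV.
     if card I = card J
     then conjugate (A $ I) * B $ J * gram_det g (basis_list I) (basis_list J)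
     else 0)"

text \<open>The outer \<open>norm\<close> is that of the scalars: it turns the scalar \<open>\<langle>A, A\<rangle>\<close>, which is a
  nonnegative real, into an element of \<open>real\<close>.\<close>

definition mv_norm :: "('a::{real_normed_field, conjugatable_field}, 'n::{finite,linorder}) vec_form \<Rightarrow>
    ('a, 'n) multivector \<Rightarrow> real" where
  "mv_norm g A = sqrt (norm (mv_inner g A A))"

definition exterior_subalgebra :: "('a::field, 'n::{finite,linorder}) coord_space set \<Rightarrow>
    ('a, 'n) multivector set" where
  "exterior_subalgebra W = vec.span {wedge_list ws | ws. set ws \<subseteq> W}"

definition mv_proj :: "('a::{real_normed_field, conjugatable_field}, 'n::{finite,linorder}) vec_form \<Rightarrow>
    ('a, 'n) coord_space set \<Rightarrow> ('a, 'n) multivector \<Rightarrow> ('a, 'n) multivector" where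
  "mv_proj g W A = (THE B. B \<in> exterior_subalgebra W \<and>
     (\<forall>C\<in>exterior_subalgebra W. mv_inner g C (A - B) = 0))"

text \<open>The description asks for one value that serves every blade representing \<open>V\<close>, so it is
  meaningful only because the quotient of norms does not depend on the blade.\<close>

definition asym_angle :: "('a::{real_normed_field, conjugatable_field}, 'n::{finite,linorder}) vec_form \<Rightarrow>
    ('a, 'n) coord_space set \<Rightarrow> ('a, 'n) coord_space set \<Rightarrow> real" where
  "asym_angle g V W = (THE \<theta>. \<forall>A. represents A V \<longrightarrow>
     \<theta> = arccos (mv_norm g (mv_proj g W A) / mv_norm g A))"


definition asymmetric_metric_on :: "'b set \<Rightarrow> ('b \<Rightarrow> 'b \<Rightarrow> ereal) \<Rightarrow> bool" where
  "asymmetric_metric_on M d \<longleftrightarrow>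
     M \<noteq> {} \<and>
     (\<forall>x\<in>M. \<forall>y\<in>M. 0 \<le> d x y) \<and>
     (\<forall>x\<in>M. \<forall>y\<in>M. d x y = 0 \<and> d y x = 0 \<longleftrightarrow> x = y) \<and>
     (\<forall>x\<in>M. \<forall>y\<in>M. \<forall>z\<in>M. d x z \<le> d x y + d y z)"

end

theory Submission
  imports Defs
begin

text \<open>The angle is a Hermitian angle between a line and a subspace of one inner product space, the
  exterior algebra: if a blade \<open>A\<close> represents \<open>V\<close>, then \<open>\<Theta>\<^bsub>V,W\<^esub>\<close> is the angle between \<open>A\<close> and the
  subspace \<open>\<And>W\<close>. All the linear algebra needed for this is obtained from one device. A matrix \<open>M\<close>
  acts on multivectors by an algebra homomorphism \<open>ext_map M\<close> (\<open>ext_map_wedge_list\<close>) whose entries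
  are the minors of \<open>M\<close>; transposing \<open>M\<close> therefore transposes \<open>ext_map M\<close>, and the form \<open>mv_inner g\<close>
  is the standard one twisted by \<open>ext_map\<close> of the Gram matrix. Writing the Gram matrix as \<open>T\<^sup>* T\<close>
  turns \<open>mv_inner g\<close> into the standard form (\<open>mv_inner_frame\<close>), and if \<open>T\<close> comes from an orthonormal
  basis adapted to \<open>W\<close>, the projection to \<open>\<And>W\<close> just forgets the coordinates \<open>K\<close> that
  are not contained in a fixed index set \<open>S\<close> (\<open>mv_proj_frame\<close>).

  The angle from \<open>V\<close> to \<open>W\<close> vanishes exactly if \<open>A\<close> lies in \<open>\<And>W\<close>, and this means \<open>V \<subseteq> W\<close>
  (\<open>asym_angle_zero_iff\<close>); both angles vanish exactly if \<open>V = W\<close>.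

  For the triangle inequality let \<open>A\<close> represent \<open>U\<close> and let \<open>B\<close> be the projection of \<open>A\<close> to \<open>\<And>V\<close>. If
  \<open>B = 0\<close>, then \<open>\<Theta>\<^bsub>U,V\<^esub> = \<pi>/2\<close>, which no angle exceeds. Otherwise \<open>B\<close> is a blade representing a
  subspace \<open>U'\<close> of \<open>V\<close>, and \<open>\<Theta>\<^bsub>U,V\<^esub>\<close> is the angle between the vectors \<open>A\<close> and \<open>B\<close>. In an inner
  product space the angle from \<open>A\<close> to \<open>\<And>W\<close> is at most the angle from \<open>A\<close> to \<open>B\<close> plus the angle
  from \<open>B\<close> to \<open>\<And>W\<close> (\<open>arccos_triangle_projection\<close>). It remains to compare the last
  angle, \<open>\<Theta>\<^bsub>U',W\<^esub>\<close>, with \<open>\<Theta>\<^bsub>V,W\<^esub>\<close>: enlarging a subspace can only increase its angle to \<open>W\<close>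
  (\<open>mv_proj_extension_contraction\<close>), because a factor \<open>w\<close> orthogonal to a blade \<open>D\<close> multiplies
  \<open>\<parallel>D\<parallel>\<close> by exactly \<open>\<parallel>w\<parallel>\<close>, whereas its projection multiplies the norm of the projected blade by at
  most \<open>\<parallel>w\<parallel>\<close>.\<close>

section \<open>Scalars\<close>

no_notation Matrix.vec_index (infixl "$" 100)

lemmas coord_eq_iff = Finite_Cartesian_Product.vec_eq_iff

text \<open>The common properties of \<open>real\<close> and \<open>complex\<close> on which the argument rests. The real inner product
  is part of the class because it makes \<open>'a ^ 'm\<close> a real inner product space: norms and angles
  of multivectors are taken there, and the last axiom relates it to the sesquilinear form.\<close>

class rc_field = real_normed_field + conjugatable_field + real_inner +
  assumes conjugate_mult_self: "conjugate x * x = scaleR (norm x ^ 2) 1"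
    and inner_conjugate: "inner x y = inner 1 (conjugate x * y)"

instance real :: rc_field
  by standard (simp add: power2_eq_square, simp)

instance complex :: rc_field
proof
  fix x y :: complex
  show "conjugate x * x = scaleR (norm x ^ 2) 1"
    by (simp only: conjugate_complex_def mult.commute[of "cnj x"] complex_norm_square[symmetric]
        scaleR_conv_of_real mult_1_right)
qed (simp add: inner_complex_def)

section \<open>The exterior product with a vector\<close>

abbreviation vwedge (infixr "\<and>\<^sub>v" 75)
  where "v \<and>\<^sub>v A \<equiv> wedge (mv_vector v) A"

text \<open>The sign that moves \<open>e\<^sub>k\<close> from the front of \<open>e\<^sub>K\<close> to its place in increasing order.\<close>

definition pos_sign :: "'n::{finite,linorder} \<Rightarrow> 'n set \<Rightarrow> 'a::field" where
  "pos_sign k K = (- 1) ^ card {j \<in> K. j < k}"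

lemma vwedge_nth:
  fixes v :: "'a::field ^ 'n::{finite,linorder}"
  shows "(v \<and>\<^sub>v A) $ K = (\<Sum>k\<in>K. pos_sign k K * v $ k * A $ (K - {k}))"
proof -
  have 1: "shuffle_sign {k} (K - {k}) = (pos_sign k K :: 'a)" if "k \<in> K" for k
  proof -
    have "{(i, j). i \<in> {k} \<and> j \<in> K - {k} \<and> j < i} = Pair k ` {j \<in> K. j < k}"
      by auto
    then show ?thesis
      by (simp add: shuffle_sign_def pos_sign_def card_image inj_on_def)
  qed
  have "(v \<and>\<^sub>v A) $ K =
      (\<Sum>I\<in>(\<lambda>k. {k}) ` K. shuffle_sign I (K - I) * mv_vector v $ I * A $ (K - I))"
    unfolding wedge_def
    by (auto intro!: sum.mono_neutral_right simp: mv_vector_def is_singleton_def)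
  also have "\<dots> = (\<Sum>k\<in>K. pos_sign k K * v $ k * A $ (K - {k}))"
    by (subst sum.reindex) (auto intro!: sum.cong simp: 1 mv_vector_def)
  finally show ?thesis .
qed

lemma vwedge_add_left: "(v + w) \<and>\<^sub>v A = v \<and>\<^sub>v A + w \<and>\<^sub>v A"
  and vwedge_add_right: "v \<and>\<^sub>v (A + B) = v \<and>\<^sub>v A + v \<and>\<^sub>v B"
  and vwedge_scale_left: "(c *s v) \<and>\<^sub>v A = c *s (v \<and>\<^sub>v A)"
  and vwedge_scale_right: "v \<and>\<^sub>v (c *s A) = c *s (v \<and>\<^sub>v A)"
  and vwedge_zero_left [simp]: "0 \<and>\<^sub>v A = 0"
  and vwedge_zero_right [simp]: "v \<and>\<^sub>v 0 = 0"
  by (auto simp: coord_eq_iff vwedge_nth algebra_simps sum.distrib sum_distrib_left)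

lemma vwedge_sum_left: "(\<Sum>i\<in>I. f i) \<and>\<^sub>v A = (\<Sum>i\<in>I. f i \<and>\<^sub>v A)"
  by (induction I rule: infinite_finite_induct) (auto simp: vwedge_add_left)

lemma vwedge_sum_right: "v \<and>\<^sub>v (\<Sum>i\<in>I. f i) = (\<Sum>i\<in>I. v \<and>\<^sub>v f i)"
  by (induction I rule: infinite_finite_induct) (auto simp: vwedge_add_right)

text \<open>Taking out the smaller of two indices first shifts the place of the larger one by one;
  in the other order nothing is shifted. This is where anticommutativity comes from.\<close>

lemma pos_sign_swap:
  assumes "k \<in> K" "l \<in> K" "k \<noteq> l"
  shows "pos_sign l K * pos_sign k (K - {l}) = - (pos_sign k K * pos_sign l (K - {k}) :: 'a::field)"
proof -
  have *: "pos_sign l K * pos_sign k (K - {l}) = - (pos_sign k K * pos_sign l (K - {k}) :: 'a)"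
    if "k \<in> K" "k < l" for k l
  proof -
    have "{j \<in> K. j < l} = insert k {j \<in> K - {k}. j < l}" "{j \<in> K - {l}. j < k} = {j \<in> K. j < k}"
      using that by auto
    then show ?thesis by (simp add: pos_sign_def)
  qed
  from assms(3) consider "k < l" | "l < k" by force
  then show ?thesis
    using *[of k l] *[of l k] assms by cases auto
qed

lemma vwedge_anticommute: "v \<and>\<^sub>v w \<and>\<^sub>v A = - (w \<and>\<^sub>v v \<and>\<^sub>v A)"
proof -
  have expand: "(v \<and>\<^sub>v w \<and>\<^sub>v A) $ K = (\<Sum>k\<in>K. \<Sum>l\<in>K. if k = l then 0 else
      pos_sign k K * pos_sign l (K - {k}) * v $ k * w $ l * A $ (K - {k} - {l}))" for v w K
    unfolding vwedge_nth sum_distrib_left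
    by (intro sum.cong refl sum.mono_neutral_cong_left) auto
  show ?thesis
  proof (rule coord_eq_iff[THEN iffD2], rule allI)
    fix K
    have "(v \<and>\<^sub>v w \<and>\<^sub>v A) $ K = (\<Sum>l\<in>K. \<Sum>k\<in>K. if k = l then 0 else
      pos_sign k K * pos_sign l (K - {k}) * v $ k * w $ l * A $ (K - {k} - {l}))"
      unfolding expand by (rule sum.swap)
    also have "\<dots> = - (w \<and>\<^sub>v v \<and>\<^sub>v A) $ K"
      unfolding expand sum_negf[symmetric]
    proof (intro sum.cong refl)
      fix k l assume "k \<in> K" "l \<in> K"
      then show "(if l = k then 0 else
          pos_sign l K * pos_sign k (K - {l}) * v $ l * w $ k * A $ (K - {l} - {k})) =
        - (if k = l then 0 else
          pos_sign k K * pos_sign l (K - {k}) * w $ k * v $ l * A $ (K - {k} - {l}))"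
        using pos_sign_swap[of k K l, where 'a='a]
        by (auto simp: Diff_insert2[symmetric] insert_commute mult_ac)
    qed
    finally show "(v \<and>\<^sub>v w \<and>\<^sub>v A) $ K = (- (w \<and>\<^sub>v v \<and>\<^sub>v A)) $ K" by simp
  qed
qed

lemma vwedge_self [simp]:
  fixes v :: "'a::real_normed_field ^ 'n::{finite,linorder}"
  shows "v \<and>\<^sub>v v \<and>\<^sub>v A = 0"
  using vwedge_anticommute[of v v A] by (simp add: coord_eq_iff eq_neg_iff_add_eq_0 flip: mult_2)

lemma wedge_list_Nil [simp]: "wedge_list [] = mv_scalar 1"
  and wedge_list_Cons [simp]: "wedge_list (v # vs) = v \<and>\<^sub>v wedge_list vs"
  by (simp_all add: wedge_list_def)

lemma vwedge_wedge_list_member: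
  fixes v :: "'a::real_normed_field ^ 'n::{finite,linorder}"
  shows "v \<in> set vs \<Longrightarrow> v \<and>\<^sub>v wedge_list vs = 0"
proof (induction vs)
  case (Cons w ws)
  show ?case
  proof (cases "v = w")
    case False
    with Cons have "v \<and>\<^sub>v wedge_list ws = 0" by simp
    then show ?thesis using vwedge_anticommute[of v w "wedge_list ws"] by simp
  qed simp
qed simp

lemma vwedge_wedge_list_span:
  fixes v :: "'a::real_normed_field ^ 'n::{finite,linorder}"
  assumes "v \<in> vec.span (set vs)"
  shows "v \<and>\<^sub>v wedge_list vs = 0"
  using assms
  by (induction rule: vec.span_induct_alt)
    (auto simp: vwedge_add_left vwedge_scale_left vwedge_wedge_list_member)

text \<open>Multivectors of different grades have disjoint coordinate supports.\<close>

lemma wedge_list_length: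
  "wedge_list vs $ K \<noteq> 0 \<Longrightarrow> card K = length vs"
proof (induction vs arbitrary: K)
  case Nil
  then show ?case by (simp add: mv_scalar_def split: if_splits)
next
  case (Cons v vs)
  then obtain k where "k \<in> K" "wedge_list vs $ (K - {k}) \<noteq> 0"
    unfolding wedge_list_Cons vwedge_nth by (metis (no_types, lifting) mult_zero_right sum.neutral)
  with Cons.IH[of "K - {k}"] show ?case
    by (metis card.remove finite length_Cons)
qed

text \<open>\<open>f i\<close> passes the smaller entries one after the other, with one change of sign each.\<close>

lemma vwedge_wedge_list_insort:
  fixes f :: "'n::{finite,linorder} \<Rightarrow> ('a::field, 'n) coord_space"
  assumes "sorted js" "distinct js" "i \<notin> set js"
  shows "f i \<and>\<^sub>v wedge_list (map f js) = pos_sign i (set js) *s wedge_list (map f (insort i js))"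
  using assms
proof (induction js)
  case Nil
  then show ?case by (simp add: pos_sign_def)
next
  case (Cons j js)
  show ?case
  proof (cases "i < j")
    case True
    have "{k. (k = j \<or> k \<in> set js) \<and> k < i} = {}" using True Cons.prems by auto
    then have "pos_sign i (set (j # js)) = (1 :: 'a)"
      by (simp only: pos_sign_def set_simps insert_iff) simp
    with True show ?thesis by (simp add: less_imp_le)
  next
    case False
    then have "j < i" using Cons.prems by auto
    then have "{k. (k = j \<or> k \<in> set js) \<and> k < i} = insert j {k \<in> set js. k < i}" by auto
    then have "pos_sign i (set (j # js)) = - (pos_sign i (set js) :: 'a)"
      using Cons.prems by (simp only: pos_sign_def set_simps insert_iff) simp
    with \<open>j < i\<close> Cons show ?thesis
      by (auto simp: vwedge_anticommute[of "f i" "f j"] vwedge_scale_right)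
  qed
qed

section \<open>The induced map on the exterior algebra\<close>

type_synonym ('a, 'n) square_matrix = "(('a, 'n) coord_space, 'n) coord_space"

text \<open>The linear extension of \<open>e\<^sub>J \<mapsto> M e\<^bsub>j1\<^esub> \<and> \<dots> \<and> M e\<^bsub>jp\<^esub>\<close>.\<close>

definition ext_map ::
  "('a::real_normed_field, 'n::{finite,linorder}) square_matrix \<Rightarrow> ('a, 'n) multivector \<Rightarrow> ('a, 'n) multivector" where
  "ext_map M A = (\<Sum>J\<in>UNIV. A $ J *s wedge_list (map ((*v) M) (basis_list J)))"

lemma ext_map_add: "ext_map M (A + B) = ext_map M A + ext_map M B"
  and ext_map_diff: "ext_map M (A - B) = ext_map M A - ext_map M B"
  and ext_map_scale: "ext_map M (c *s A) = c *s ext_map M A"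
  and ext_map_zero [simp]: "ext_map M 0 = 0"
  by (auto simp: ext_map_def coord_eq_iff sum.distrib sum_subtractf algebra_simps sum_distrib_left)

lemma ext_map_sum: "ext_map M (\<Sum>i\<in>I. f i) = (\<Sum>i\<in>I. ext_map M (f i))"
  by (induction I rule: infinite_finite_induct) (auto simp: ext_map_add)

lemma ext_map_axis: "ext_map M (axis J 1) = wedge_list (map ((*v) M) (basis_list J))"
  by (simp add: ext_map_def axis_def if_distrib[of "\<lambda>c. c *s _"] cong: if_cong)

lemma vwedge_axis:
  "(axis i 1 :: ('a::field, 'n::{finite,linorder}) coord_space) \<and>\<^sub>v axis J 1 =
    (if i \<in> J then 0 else pos_sign i J *s axis (insert i J) 1)"
proof (rule coord_eq_iff[THEN iffD2], rule allI)
  fix K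
  have "((axis i 1 :: ('a, 'n) coord_space) \<and>\<^sub>v axis J 1) $ K =
      (\<Sum>k\<in>K. if k = i then (if K - {i} = J then pos_sign i K else 0) else 0)"
    unfolding vwedge_nth by (intro sum.cong) (auto simp: axis_def)
  also have "\<dots> = (if i \<in> K \<and> K - {i} = J then pos_sign i K else 0)"
    by auto
  also have "\<dots> = (if i \<in> J then 0 else pos_sign i J *s axis (insert i J) 1) $ K"
  proof (cases "i \<notin> J \<and> K = insert i J")
    case True
    then have "{j \<in> K. j < i} = {j \<in> J. j < i}" by auto
    with True show ?thesis by (simp add: pos_sign_def axis_def)
  qed (auto simp: axis_def)
  finally show "((axis i 1 :: ('a, 'n) coord_space) \<and>\<^sub>v axis J 1) $ K =
    (if i \<in> J then 0 else pos_sign i J *s axis (insert i J) 1) $ K" .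
qed

lemma wedge_list_basis_list:
  "wedge_list (basis_list J) = (axis J 1 :: ('a::field, 'n::{finite,linorder}) multivector)"
proof -
  have "wedge_list (map (\<lambda>i. axis i 1) js) = (axis (set js) 1 :: ('a, 'n) multivector)"
    if "sorted js" "distinct js" for js :: "'n list"
    using that
  proof (induction js)
    case Nil
    show ?case by (auto simp: mv_scalar_def axis_def coord_eq_iff)
  next
    case (Cons j js)
    then have "{k \<in> set js. k < j} = {}" by auto
    then have "pos_sign j (set js) = (1 :: 'a)" by (simp only: pos_sign_def) simp
    with Cons show ?case by (simp add: vwedge_axis)
  qed
  then show ?thesis by (simp add: basis_list_def)
qed

text \<open>Both sides are bilinear, so it is enough to compare them on basis elements. There the left side is
  zero or a signed sorted product, and the right side is brought to the same form by sorting.\<close>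

lemma ext_map_vwedge: "ext_map M (v \<and>\<^sub>v A) = (M *v v) \<and>\<^sub>v ext_map M A"
proof -
  have axes: "ext_map M (axis i 1 \<and>\<^sub>v axis J 1) = (M *v axis i 1) \<and>\<^sub>v ext_map M (axis J 1)" for i J
  proof (cases "i \<in> J")
    case True
    then show ?thesis
      unfolding vwedge_axis ext_map_axis
      by (auto simp: basis_list_def vwedge_wedge_list_member)
  next
    case False
    then show ?thesis
      using vwedge_wedge_list_insort[of "sorted_list_of_set J" i "\<lambda>i. M *v axis i 1"]
      by (simp add: vwedge_axis ext_map_scale ext_map_axis basis_list_def comp_def)
  qed
  have "ext_map M ((\<Sum>i\<in>UNIV. v $ i *s axis i 1) \<and>\<^sub>v (\<Sum>J\<in>UNIV. A $ J *s axis J 1)) =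
    (M *v (\<Sum>i\<in>UNIV. v $ i *s axis i 1)) \<and>\<^sub>v ext_map M (\<Sum>J\<in>UNIV. A $ J *s axis J 1)"
    by (simp add: vwedge_sum_left vwedge_sum_right vwedge_scale_left vwedge_scale_right axes
      ext_map_sum ext_map_scale vec.linear_sum[OF matrix_vector_mul_linear_gen]
      vec.linear_scale[OF matrix_vector_mul_linear_gen])
  then show ?thesis by (simp add: basis_expansion)
qed

lemma ext_map_scalar_one [simp]:
  "ext_map M (mv_scalar 1) = (mv_scalar 1 :: ('a::real_normed_field, 'n::{finite,linorder}) multivector)"
proof -
  have "mv_scalar 1 = (axis {} 1 :: ('a, 'n) multivector)" by (auto simp: mv_scalar_def axis_def coord_eq_iff)
  then show ?thesis using ext_map_axis[of M "{}"] by (auto simp: basis_list_def)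
qed

lemma ext_map_wedge_list: "ext_map M (wedge_list vs) = wedge_list (map ((*v) M) vs)"
  by (induction vs) (simp_all add: ext_map_vwedge)

lemma ext_map_ext_map: "ext_map M (ext_map N A) = ext_map (M ** N) A"
proof -
  have "ext_map M (ext_map N A) = (\<Sum>J\<in>UNIV. A $ J *s wedge_list (map ((*v) M) (map ((*v) N) (basis_list J))))"
    by (simp only: ext_map_def[of N] ext_map_sum ext_map_scale ext_map_wedge_list)
  then show ?thesis by (simp add: ext_map_def comp_def matrix_vector_mul_assoc)
qed

lemma ext_map_id:
  "ext_map (Finite_Cartesian_Product.mat 1) A = (A :: ('a::real_normed_field, 'n::{finite,linorder}) multivector)"
proof -
  have id: "(*v) (Finite_Cartesian_Product.mat 1) = (\<lambda>x :: ('a, 'n) coord_space. x)" by auto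
  show ?thesis
    unfolding ext_map_def id by (simp add: wedge_list_basis_list basis_expansion)
qed

section \<open>Coordinates are minors\<close>

text \<open>The exterior product with the first vector expands a coordinate exactly as Laplace expansion along
  the first row expands a determinant.\<close>

lemma wedge_list_nth:
  fixes vs :: "('a::field, 'n::{finite,linorder}) coord_space list"
  shows "wedge_list vs $ I = (if card I = length vs
    then Determinant.det (Matrix.mat (length vs) (length vs) (\<lambda>(i, j). vs ! i $ (sorted_list_of_set I ! j)))
    else 0)"
proof (induction vs arbitrary: I)
  case Nil
  show ?case by (simp add: mv_scalar_def)
next
  case (Cons v vs)
  show ?case
  proof (cases "card I = Suc (length vs)")
    case False
    then show ?thesis using wedge_list_length[of "v # vs" I] by auto
  next
    case True
    define js where "js = sorted_list_of_set I"
    define D where "D = Matrix.mat (Suc (length vs)) (Suc (length vs)) (\<lambda>(i, j). (v # vs) ! i $ (js ! j))"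
    have js: "sorted js" "distinct js" "set js = I" "length js = Suc (length vs)"
      using True by (simp_all add: js_def)
    have bij: "bij_betw ((!) js) {..<Suc (length vs)} I"
      using js by (metis bij_betw_nth)
    have minor: "pos_sign (js ! j) I * wedge_list vs $ (I - {js ! j}) = cofactor D 0 j"
      if "j < Suc (length vs)" for j
    proof -
      \<comment> \<open>the columns that remain after deleting the one indexed by the \<open>j\<close>-th element of \<open>I\<close>\<close>
      define as bs where "as = take j js" and "bs = drop (Suc j) js"
      have split: "js = as @ js ! j # bs" and len: "length as = j"
        using that js(4) id_take_nth_drop[of j js] by (auto simp: as_def bs_def)
      have sorted: "sorted (as @ js ! j # bs)" and dist: "distinct (as @ js ! j # bs)"
        using js(1,2) split by simp_all
      have "sorted_list_of_set (I - {js ! j}) = as @ bs"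
      proof (rule sorted_distinct_set_unique)
        show "sorted (as @ bs)" using sorted by (auto simp: sorted_append)
        show "distinct (as @ bs)" using dist by auto
        have "I = set (as @ js ! j # bs)" using js(3) split by simp
        then show "set (sorted_list_of_set (I - {js ! j})) = set (as @ bs)"
          using dist by auto
      qed simp_all
      moreover have "(as @ bs) ! i = js ! (if i < j then i else Suc i)" for i
      proof -
        have "(as @ js ! j # bs) ! (if i < j then i else Suc i) = (as @ bs) ! i"
          by (auto simp: nth_append len Suc_diff_le)
        then show ?thesis by (simp only: split[symmetric])
      qed
      ultimately have remove: "sorted_list_of_set (I - {js ! j}) ! i = js ! (if i < j then i else Suc i)" for i
        by simp
      have "{k \<in> I. k < js ! j} = set as"
      proof -
        have "I = set (as @ js ! j # bs)" using js(3) split by simp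
        then show ?thesis using sorted dist by (force simp: sorted_append)
      qed
      then have "card {k \<in> I. k < js ! j} = j"
        using dist len by (simp add: distinct_card)
      then have sign: "pos_sign (js ! j) I = (- 1 :: 'a) ^ j"
        by (simp add: pos_sign_def)
      have "card (I - {js ! j}) = length vs"
        using True that js by (metis card_Diff_singleton diff_Suc_1 nth_mem)
      then have "wedge_list vs $ (I - {js ! j}) = Determinant.det (Matrix.mat (length vs) (length vs)
          (\<lambda>(i, l). vs ! i $ (sorted_list_of_set (I - {js ! j}) ! l)))"
        using Cons.IH[of "I - {js ! j}"] by simp
      also have "Matrix.mat (length vs) (length vs)
          (\<lambda>(i, l). vs ! i $ (sorted_list_of_set (I - {js ! j}) ! l)) = mat_delete D 0 j"
        by (rule eq_matI) (auto simp: mat_delete_def D_def remove)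
      finally show ?thesis by (simp add: cofactor_def sign)
    qed
    have "wedge_list (v # vs) $ I = (\<Sum>k\<in>I. v $ k * (pos_sign k I * wedge_list vs $ (I - {k})))"
      by (simp add: vwedge_nth mult_ac)
    also have "\<dots> = (\<Sum>j<Suc (length vs). v $ (js ! j) * (pos_sign (js ! j) I * wedge_list vs $ (I - {js ! j})))"
      by (rule sum.reindex_bij_betw[OF bij, symmetric])
    also have "\<dots> = (\<Sum>j<Suc (length vs). D $$ (0, j) * cofactor D 0 j)"
      by (intro sum.cong refl) (simp only: minor lessThan_iff, simp add: D_def)
    also have "\<dots> = Determinant.det D"
      by (rule laplace_expansion_row[symmetric]) (auto simp: D_def)
    finally show ?thesis using True by (simp add: D_def js_def)
  qed
qed

lemma matrix_vector_axis: "(M *v axis i 1) $ k = (M :: ('a::comm_ring_1, 'n::finite) square_matrix) $ k $ i"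
  by (simp add: matrix_vector_mult_def axis_def if_distrib cong: if_cong)

lemma wedge_list_minor:
  fixes M :: "('a::field, 'n::{finite,linorder}) square_matrix"
  shows "wedge_list (map ((*v) M) (basis_list J)) $ I = (if card I = card J
    then Determinant.det (Matrix.mat (card J) (card J)
      (\<lambda>(j, i). M $ (sorted_list_of_set I ! i) $ (sorted_list_of_set J ! j)))
    else 0)"
  unfolding wedge_list_nth
  by (auto simp: basis_list_def matrix_vector_axis intro!: arg_cong[of _ _ Determinant.det] eq_matI)

text \<open>The matrix of \<open>ext_map M\<close> consists of the minors of \<open>M\<close>, and a determinant does not change under
  transposition. With functoriality this takes the place of the Cauchy-Binet formula.\<close>

lemma wedge_list_minor_transpose:
  fixes M :: "('a::field, 'n::{finite,linorder}) square_matrix"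
  shows "wedge_list (map ((*v) M) (basis_list J)) $ I =
    wedge_list (map ((*v) (Finite_Cartesian_Product.transpose M)) (basis_list I)) $ J"
proof (cases "card I = card J")
  case True
  let ?D = "Matrix.mat (card J) (card J)
      (\<lambda>(j, i). M $ (sorted_list_of_set I ! i) $ (sorted_list_of_set J ! j))"
  have "Determinant.det ?D = Determinant.det (transpose_mat ?D)"
    by (rule det_transpose[of _ "card J", symmetric]) simp
  also have "transpose_mat ?D = Matrix.mat (card J) (card J)
      (\<lambda>(j, i). Finite_Cartesian_Product.transpose M $ (sorted_list_of_set J ! i) $ (sorted_list_of_set I ! j))"
    by (rule eq_matI) (auto simp: Finite_Cartesian_Product.transpose_def)
  finally show ?thesis using True by (simp add: wedge_list_minor)
qed (simp add: wedge_list_minor)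

lemma conjugate_one [simp]: "conjugate 1 = (1 :: 'a::conjugatable_field)"
  using conjugate_dist_mul[of 1 "1 :: 'a"] by simp

lemma conjugate_power_minus_one [simp]: "conjugate ((- 1) ^ n) = ((- 1) ^ n :: 'a::conjugatable_field)"
  by (induction n) (simp_all add: conjugate_neg)

definition conj_vec :: "'a::conjugatable_field ^ 'n::finite \<Rightarrow> 'a ^ 'n" where
  "conj_vec v = (\<chi> i. conjugate (v $ i))"

lemma conjugate_wedge_list_nth:
  "conjugate (wedge_list vs $ K) = wedge_list (map conj_vec vs) $ K"
proof (induction vs arbitrary: K)
  case (Cons v vs)
  then show ?case
    by (simp add: vwedge_nth sum_conjugate conjugate_dist_mul pos_sign_def conj_vec_def)
qed (simp add: mv_scalar_def)

definition cinner :: "'a::conjugatable_field ^ 'n::finite \<Rightarrow> 'a ^ 'n \<Rightarrow> 'a" where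
  "cinner x y = (\<Sum>k\<in>UNIV. conjugate (x $ k) * y $ k)"

definition adjoint_matrix :: "('a::conjugatable_field, 'n::finite) square_matrix \<Rightarrow> ('a, 'n) square_matrix" where
  "adjoint_matrix M = (\<chi> i j. conjugate (M $ j $ i))"

text \<open>\<open>ext_map\<close> respects adjoints, since it respects both transposition and conjugation of the entries.\<close>

lemma cinner_ext_map_adjoint:
  fixes M :: "('a::{real_normed_field,conjugatable_field}, 'n::{finite,linorder}) square_matrix"
  shows "cinner A (ext_map (adjoint_matrix M) B) = cinner (ext_map M A) B"
proof -
  have minors: "wedge_list (map ((*v) (adjoint_matrix M)) (basis_list J)) $ I =
      conjugate (wedge_list (map ((*v) M) (basis_list I)) $ J)" for I J
  proof -
    have "map ((*v) (Finite_Cartesian_Product.transpose (adjoint_matrix M))) (basis_list I) =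
        map conj_vec (map ((*v) M) (basis_list I))"
      by (simp add: basis_list_def coord_eq_iff matrix_vector_axis conj_vec_def adjoint_matrix_def
          Finite_Cartesian_Product.transpose_def)
    then show ?thesis
      by (simp only: wedge_list_minor_transpose[of "adjoint_matrix M"] conjugate_wedge_list_nth)
  qed
  have "cinner A (ext_map (adjoint_matrix M) B) =
    (\<Sum>I\<in>UNIV. \<Sum>J\<in>UNIV. conjugate (A $ I) * (B $ J * conjugate (wedge_list (map ((*v) M) (basis_list I)) $ J)))"
    by (simp add: cinner_def ext_map_def minors sum_distrib_left)
  also have "\<dots> = (\<Sum>J\<in>UNIV. \<Sum>I\<in>UNIV. conjugate (A $ I) * (B $ J * conjugate (wedge_list (map ((*v) M) (basis_list I)) $ J)))"
    by (rule sum.swap)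
  also have "\<dots> = cinner (ext_map M A) B"
    by (simp add: cinner_def ext_map_def sum_conjugate conjugate_dist_mul sum_distrib_left sum_distrib_right mult_ac)
  finally show ?thesis .
qed

definition gram_matrix :: "('a::field, 'n::finite) vec_form \<Rightarrow> ('a, 'n) square_matrix" where
  "gram_matrix g = (\<chi> i j. g (axis i 1) (axis j 1))"

text \<open>The Gram determinants of basis vectors are the minors of the Gram matrix, hence the entries of the
  matrix of its \<open>ext_map\<close>; the entries between different grades are zero, because \<open>ext_map\<close>
  preserves the grade.\<close>

lemma mv_inner_gram: "mv_inner g A B = cinner A (ext_map (gram_matrix g) B)"
proof -
  have "gram_det g (basis_list I) (basis_list J) = wedge_list (map ((*v) (gram_matrix g)) (basis_list J)) $ I"
    if "card I = card J" for I J
    using that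
    unfolding wedge_list_minor_transpose[of "gram_matrix g"] unfolding wedge_list_minor gram_det_def
    by (auto simp: basis_list_def gram_matrix_def
        Finite_Cartesian_Product.transpose_def intro!: arg_cong[of _ _ Determinant.det] eq_matI)
  then have "(if card I = card J then conjugate (A $ I) * B $ J * gram_det g (basis_list I) (basis_list J) else 0)
    = conjugate (A $ I) * (B $ J * wedge_list (map ((*v) (gram_matrix g)) (basis_list J)) $ I)" for I J
    by (simp add: wedge_list_minor)
  then show ?thesis
    by (simp add: mv_inner_def cinner_def ext_map_def sum_distrib_left)
qed

section \<open>Orthonormal bases\<close>

lemma conjugate_of_real [simp]: "conjugate (of_real r) = (of_real r :: 'a::rc_field)"
proof (cases "r = 0")
  case False
  have "conjugate (of_real r :: 'a) * of_real r = of_real r * of_real r"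
    using conjugate_mult_self[of "of_real r :: 'a"]
    by (simp add: scaleR_conv_of_real power2_eq_square flip: of_real_mult)
  with False show ?thesis by simp
qed simp

lemma cinner_self: "cinner x x = (of_real (norm x ^ 2) :: 'a::rc_field)"
  by (simp add: cinner_def conjugate_mult_self scaleR_conv_of_real power2_norm_eq_inner inner_vec_def
      flip: of_real_power)

lemma inner_eq_cinner: "inner x y = inner 1 (cinner x y)" for x y :: "'a::rc_field ^ 'n::finite"
  by (simp add: cinner_def inner_vec_def inner_conjugate[of "x $ _"] inner_sum_right)

definition orthonormal_set :: "('a::rc_field, 'n::finite) vec_form \<Rightarrow> ('a, 'n) coord_space set \<Rightarrow> bool" where
  "orthonormal_set g B \<longleftrightarrow> (\<forall>x\<in>B. \<forall>y\<in>B. g x y = (if x = y then 1 else 0))"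

context
  fixes g :: "('a::rc_field, 'n::{finite,linorder}) vec_form"
  assumes g: "inner_product g"
begin

lemma form_add_right: "g x (y + z) = g x y + g x z"
  and form_scale_right: "g x (c *s y) = c * g x y"
  and form_conjugate: "g y x = conjugate (g x y)"
  and form_positive: "x \<noteq> 0 \<Longrightarrow> \<exists>r > 0. g x x = of_real r"
  using g unfolding inner_product_def by blast+

lemma form_zero_right [simp]: "g x 0 = 0"
  using form_scale_right[of x 0 0] by simp

lemma form_sum_right: "g x (\<Sum>i\<in>I. f i) = (\<Sum>i\<in>I. g x (f i))"
  by (induction I rule: infinite_finite_induct) (auto simp: form_add_right)

lemma form_diff_right: "g x (y - z) = g x y - g x z"
  using form_add_right[of x "y - z" z] by (simp add: algebra_simps)

lemma form_scale_left: "g (c *s x) y = conjugate c * g x y"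
  by (metis form_conjugate form_scale_right conjugate_dist_mul)

lemma form_sum_left: "g (\<Sum>i\<in>I. f i) y = (\<Sum>i\<in>I. g (f i) y)"
proof (cases "finite I")
  case True
  have "g (\<Sum>i\<in>I. f i) y = conjugate (g y (\<Sum>i\<in>I. f i))" by (rule form_conjugate)
  also have "\<dots> = (\<Sum>i\<in>I. conjugate (g y (f i)))" by (simp add: form_sum_right sum_conjugate True)
  also have "\<dots> = (\<Sum>i\<in>I. g (f i) y)" by (intro sum.cong refl form_conjugate[symmetric])
  finally show ?thesis .
qed (use form_scale_left[of 0 0] in simp)

lemma orthonormal_independent:
  assumes "orthonormal_set g B"
  shows "vec.independent B"
  unfolding vec.dependent_explicit
proof (intro notI, elim exE conjE bexE)
  fix S u v
  assume S: "finite S" "S \<subseteq> B" "(\<Sum>v\<in>S. u v *s v) = 0" and v: "v \<in> S" "u v \<noteq> 0"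
  have "0 = g v (\<Sum>v\<in>S. u v *s v)" using S by simp
  also have "\<dots> = (\<Sum>w\<in>S. if w = v then u v else 0)"
    unfolding form_sum_right form_scale_right
    using assms S v by (intro sum.cong) (auto simp: orthonormal_set_def subset_iff)
  finally show False using S v by simp
qed

text \<open>An orthonormal set of greatest cardinality between \<open>B\<close> and \<open>W\<close> spans \<open>W\<close>, as otherwise one step
  of the Gram-Schmidt process would enlarge it. Independence bounds the cardinalities.\<close>

lemma orthonormal_extend:
  assumes W: "vec.subspace W" and B: "orthonormal_set g B" "B \<subseteq> W"
  obtains C where "orthonormal_set g C" "B \<subseteq> C" "vec.span C = W"
proof -
  let ?P = "\<lambda>C. orthonormal_set g C \<and> B \<subseteq> C \<and> C \<subseteq> W"
  have fin: "finite C" and bound: "card C \<le> vec.dim (UNIV :: ('a, 'n) coord_space set)" if "?P C" for C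
    using that orthonormal_independent vec.finiteI_independent
      vec.independent_card_le_dim[of C UNIV] by auto
  obtain C where C: "?P C" and maximal: "\<And>D. ?P D \<Longrightarrow> card D \<le> card C"
    using ex_has_greatest_nat[of ?P B card "Suc (vec.dim (UNIV :: ('a, 'n) coord_space set))"] B bound
    by (auto simp: less_Suc_eq_le)
  have "W \<subseteq> vec.span C"
  proof (rule subsetI, rule ccontr)
    fix v assume v: "v \<in> W" "v \<notin> vec.span C"
    define w where "w = v - (\<Sum>b\<in>C. g b v *s b)"
    have "(\<Sum>b\<in>C. g b v *s b) \<in> vec.span C"
      by (intro vec.span_sum vec.span_scale vec.span_base)
    with v have "w \<noteq> 0" by (auto simp: w_def)
    then obtain r where r: "r > 0" "g w w = of_real r" using form_positive by blast
    have "w \<in> W"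
      unfolding w_def using C v W
      by (intro vec.subspace_diff vec.subspace_sum vec.subspace_scale) auto
    have orth: "g b w = 0" if "b \<in> C" for b
    proof -
      have "g b (\<Sum>c\<in>C. g c v *s c) = (\<Sum>c\<in>C. if c = b then g b v else 0)"
        unfolding form_sum_right form_scale_right
        using C that by (intro sum.cong) (auto simp: orthonormal_set_def)
      then show ?thesis using that fin[OF C] by (simp add: w_def form_diff_right)
    qed
    define u where "u = of_real (1 / sqrt r) *s w"
    have "g u u = of_real (1 / sqrt r * (1 / sqrt r) * r)"
      by (simp only: u_def form_scale_left form_scale_right r conjugate_of_real of_real_mult mult.assoc)
    also have "\<dots> = 1" using r by (simp add: field_simps)
    finally have unit: "g u u = 1" .
    have orth_u: "g b u = 0" "g u b = 0" if "b \<in> C" for b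
      using orth[OF that] form_conjugate[of u b] by (simp_all add: u_def form_scale_right)
    have "?P (insert u C)"
      using C unit orth_u \<open>w \<in> W\<close> W
      by (auto simp: orthonormal_set_def u_def intro: vec.subspace_scale)
    moreover have "u \<notin> C" using unit orth_u(1) by fastforce
    ultimately show False using maximal[of "insert u C"] fin[OF C] by auto
  qed
  moreover have "vec.span C \<subseteq> W" using C W by (intro vec.span_minimal) auto
  ultimately show thesis using C that by blast
qed

end

text \<open>\<open>T\<close> takes a vector to its coordinates in a \<open>g\<close>-orthonormal basis, and \<open>T'\<close> takes the coordinates
  back. In an adapted frame, the basis vectors with index in \<open>S\<close> form a basis of \<open>W\<close>.\<close>

definition frame :: "('a::rc_field, 'n::{finite,linorder}) vec_form \<Rightarrow>
    ('a, 'n) square_matrix \<Rightarrow> ('a, 'n) square_matrix \<Rightarrow> bool" where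
  "frame g T T' \<longleftrightarrow> (\<forall>x. T' *v (T *v x) = x) \<and> (\<forall>x. T *v (T' *v x) = x) \<and>
     (\<forall>x y. g x y = cinner (T *v x) (T *v y))"

definition adapted_frame :: "('a::rc_field, 'n::{finite,linorder}) vec_form \<Rightarrow> ('a, 'n) coord_space set \<Rightarrow>
    ('a, 'n) square_matrix \<Rightarrow> ('a, 'n) square_matrix \<Rightarrow> 'n set \<Rightarrow> bool" where
  "adapted_frame g W T T' S \<longleftrightarrow> frame g T T' \<and> (\<forall>x. x \<in> W \<longleftrightarrow> (\<forall>k. k \<notin> S \<longrightarrow> (T *v x) $ k = 0))"

lemma adapted_frame_exists:
  fixes g :: "('a::rc_field, 'n::{finite,linorder}) vec_form"
  assumes g: "inner_product g" and W: "vec.subspace W"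
  obtains T T' S where "adapted_frame g W T T' S"
proof -
  obtain C where C: "orthonormal_set g C" "vec.span C = W"
    using orthonormal_extend[OF g W, of "{}"] orthonormal_set_def[of g "{}"] by auto
  obtain B where B: "orthonormal_set g B" "C \<subseteq> B" "vec.span B = UNIV"
    using orthonormal_extend[OF g vec.subspace_UNIV C(1)] by auto
  have ind: "vec.independent B" by (rule orthonormal_independent[OF g B(1)])
  have "card B = CARD('n)"
  proof -
    have "cart_basis = range (\<lambda>i. axis i 1 :: ('a, 'n) coord_space)"
      by (auto simp: cart_basis_def)
    moreover have "card (range (\<lambda>i. axis i 1 :: ('a, 'n) coord_space)) = CARD('n)"
      by (rule card_image) (simp add: inj_on_def axis_eq_axis)
    ultimately have "card (cart_basis :: ('a, 'n) coord_space set) = CARD('n)"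
      by (simp only:)
    then show ?thesis using vec.dim_eq_card[of B UNIV] B ind by simp
  qed
  moreover have "finite B" using ind by (rule vec.finiteI_independent)
  ultimately obtain b :: "'n \<Rightarrow> ('a, 'n) coord_space" where bij: "bij_betw b UNIV B"
    by (metis finite_same_card_bij finite)
  have ortho: "g (b k) (b l) = (if k = l then 1 else 0)" for k l
    using B(1) bij unfolding orthonormal_set_def bij_betw_def inj_def by (metis rangeI)
  define T where "T = (\<chi> k i. g (b k) (axis i 1))"
  define T' where "T' = (\<chi> i k. b k $ i)"
  have T: "(T *v x) $ k = g (b k) x" for x k
  proof -
    have "g (b k) x = g (b k) (\<Sum>i\<in>UNIV. x $ i *s axis i 1)" by (simp add: basis_expansion)
    then show ?thesis
      by (simp add: T_def matrix_vector_mult_def form_sum_right[OF g] form_scale_right[OF g] mult.commute)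
  qed
  have T': "T' *v y = (\<Sum>k\<in>UNIV. y $ k *s b k)" for y
    by (simp add: T'_def matrix_vector_mult_def coord_eq_iff mult.commute)
  have TT': "T *v (T' *v y) = y" for y
    by (simp add: coord_eq_iff T T' form_sum_right[OF g] form_scale_right[OF g] ortho if_distrib cong: if_cong)
  then have "T ** T' = Finite_Cartesian_Product.mat 1"
    by (simp add: matrix_eq matrix_vector_mul_assoc)
  then have "T' ** T = Finite_Cartesian_Product.mat 1" by (rule matrix_left_right_inverse1)
  then have T'T: "T' *v (T *v x) = x" for x by (simp add: matrix_vector_mul_assoc)
  have iso: "g x y = cinner (T *v x) (T *v y)" for x y
  proof -
    have "g x y = g (\<Sum>k\<in>UNIV. (T *v x) $ k *s b k) y" using T'T[of x] T' by simp
    then show ?thesis by (simp add: form_sum_left[OF g] form_scale_left[OF g] cinner_def T)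
  qed
  have "x \<in> W \<longleftrightarrow> (\<forall>k. k \<notin> b -` C \<longrightarrow> (T *v x) $ k = 0)" for x
  proof
    assume "x \<in> W"
    then have "x \<in> vec.span C" using C by simp
    then show "\<forall>k. k \<notin> b -` C \<longrightarrow> (T *v x) $ k = 0"
    proof (induction rule: vec.span_induct_alt)
      case (step c v z)
      then obtain l where "v = b l" using B(2) bij by (auto simp: bij_betw_def)
      with step show ?case
        by (auto simp: T form_add_right[OF g] form_scale_right[OF g] ortho)
    qed simp
  next
    assume *: "\<forall>k. k \<notin> b -` C \<longrightarrow> (T *v x) $ k = 0"
    have "x = (\<Sum>k\<in>UNIV. (T *v x) $ k *s b k)" using T'T[of x] T' by simp
    also have "\<dots> \<in> vec.span C"
    proof (rule vec.span_sum)
      fix k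
      show "(T *v x) $ k *s b k \<in> vec.span C"
        using * by (cases "b k \<in> C") (auto intro: vec.span_scale vec.span_base vec.span_zero)
    qed
    finally show "x \<in> W" using C by simp
  qed
  with TT' T'T iso show thesis
    by (intro that[of T T' "b -` C"]) (auto simp: adapted_frame_def frame_def)
qed

lemma ext_map_frame_inverse:
  assumes "frame g T T'"
  shows "ext_map T' (ext_map T A) = A" "ext_map T (ext_map T' A) = A"
proof -
  have "T' ** T = Finite_Cartesian_Product.mat 1" "T ** T' = Finite_Cartesian_Product.mat 1"
    using assms by (simp_all add: frame_def matrix_eq matrix_vector_mul_assoc)
  then show "ext_map T' (ext_map T A) = A" "ext_map T (ext_map T' A) = A"
    by (simp_all add: ext_map_ext_map ext_map_id)
qed

text \<open>The Gram matrix factors as \<open>T\<^sup>* T\<close>, and \<open>ext_map\<close> respects products and adjoints.\<close>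

lemma mv_inner_frame:
  assumes "frame g T T'"
  shows "mv_inner g A B = cinner (ext_map T A) (ext_map T B)"
proof -
  have "gram_matrix g = adjoint_matrix T ** T"
    using assms
    by (simp add: frame_def gram_matrix_def adjoint_matrix_def coord_eq_iff matrix_matrix_mult_def
        cinner_def matrix_vector_axis)
  then show ?thesis
    by (simp add: mv_inner_gram cinner_ext_map_adjoint flip: ext_map_ext_map)
qed

lemma mv_norm_frame:
  assumes "frame g T T'"
  shows "mv_norm g A = norm (ext_map T A)"
  by (simp add: mv_norm_def mv_inner_frame[OF assms] cinner_self norm_power flip: of_real_power)

section \<open>Projections in adapted coordinates\<close>

lemma power2_norm_vec: "norm x ^ 2 = (\<Sum>i\<in>UNIV. norm (x $ i) ^ 2)"
  for x :: "'a::real_inner ^ 'n::finite"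
  by (simp add: power2_norm_eq_inner inner_vec_def)

lemma norm_vector_scalar_mult: "norm (c *s x) = norm c * norm x"
  for x :: "'a::rc_field ^ 'n::finite"
proof -
  have "norm (c *s x) ^ 2 = (norm c * norm x) ^ 2"
    by (simp add: power2_norm_vec power_mult_distrib norm_mult sum_distrib_left)
  then show ?thesis by simp
qed

text \<open>The product with \<open>e\<^sub>k\<close> moves, up to sign, the coordinates with \<open>k \<notin> K\<close> to \<open>insert k K\<close> and
  kills all the others.\<close>

lemma norm_axis_vwedge:
  fixes B :: "('a::rc_field, 'n::{finite,linorder}) multivector"
  shows "norm (axis k 1 \<and>\<^sub>v B) \<le> norm B"
    and "(\<And>K. k \<in> K \<Longrightarrow> B $ K = 0) \<Longrightarrow> norm (axis k 1 \<and>\<^sub>v B) = norm B"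
proof -
  have nth: "norm ((axis k 1 \<and>\<^sub>v B) $ K) = (if k \<in> K then norm (B $ (K - {k})) else 0)" for K
  proof -
    have "(axis k 1 \<and>\<^sub>v B) $ K = (\<Sum>l\<in>K. if l = k then pos_sign k K * B $ (K - {k}) else 0)"
      unfolding vwedge_nth by (intro sum.cong) (auto simp: axis_def)
    then show ?thesis by (simp add: norm_mult pos_sign_def norm_power)
  qed
  have "norm (axis k 1 \<and>\<^sub>v B) ^ 2 = (\<Sum>K\<in>{K. k \<in> K}. norm (B $ (K - {k})) ^ 2)"
    unfolding power2_norm_vec nth by (rule sum.mono_neutral_cong_right) auto
  also have "\<dots> = (\<Sum>K\<in>{K. k \<notin> K}. norm (B $ K) ^ 2)"
    by (rule sum.reindex_bij_witness[of _ "insert k" "\<lambda>K. K - {k}"]) auto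
  finally have *: "norm (axis k 1 \<and>\<^sub>v B) ^ 2 = (\<Sum>K\<in>{K. k \<notin> K}. norm (B $ K) ^ 2)" .
  have "norm (axis k 1 \<and>\<^sub>v B) ^ 2 \<le> norm B ^ 2"
    unfolding * unfolding power2_norm_vec by (rule sum_mono2) auto
  then show "norm (axis k 1 \<and>\<^sub>v B) \<le> norm B" by (simp add: power2_le_iff_abs_le)
  assume "\<And>K. k \<in> K \<Longrightarrow> B $ K = 0"
  then have "norm (axis k 1 \<and>\<^sub>v B) ^ 2 = norm B ^ 2"
    unfolding * unfolding power2_norm_vec by (intro sum.mono_neutral_left) auto
  then show "norm (axis k 1 \<and>\<^sub>v B) = norm B" by simp
qed

definition vec_restrict :: "'n set \<Rightarrow> ('a::field, 'n::finite) coord_space \<Rightarrow> ('a, 'n) coord_space" where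
  "vec_restrict S x = (\<chi> k. if k \<in> S then x $ k else 0)"

definition mv_restrict :: "'n set \<Rightarrow> ('a::field, 'n::finite) multivector \<Rightarrow> ('a, 'n) multivector" where
  "mv_restrict S A = (\<chi> K. if K \<subseteq> S then A $ K else 0)"

lemma mv_restrict_add: "mv_restrict S (A + B) = mv_restrict S A + mv_restrict S B"
  and mv_restrict_diff: "mv_restrict S (A - B) = mv_restrict S A - mv_restrict S B"
  and mv_restrict_scale: "mv_restrict S (c *s A) = c *s mv_restrict S A"
  and mv_restrict_zero [simp]: "mv_restrict S 0 = 0"
  and mv_restrict_idem [simp]: "mv_restrict S (mv_restrict S A) = mv_restrict S A"
  by (auto simp: mv_restrict_def coord_eq_iff)

lemma mv_restrict_scalar [simp]: "mv_restrict S (mv_scalar c) = mv_scalar c"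
  by (auto simp: mv_restrict_def mv_scalar_def coord_eq_iff)

text \<open>\<open>mv_restrict S\<close> is the map of exterior algebras induced by \<open>vec_restrict S\<close>.\<close>

lemma mv_restrict_vwedge:
  "mv_restrict S (v \<and>\<^sub>v A) = vec_restrict S v \<and>\<^sub>v mv_restrict S A"
proof (rule coord_eq_iff[THEN iffD2], rule allI)
  fix K
  show "mv_restrict S (v \<and>\<^sub>v A) $ K = (vec_restrict S v \<and>\<^sub>v mv_restrict S A) $ K"
  proof (cases "K \<subseteq> S")
    case True
    then show ?thesis
      by (auto simp: mv_restrict_def vec_restrict_def vwedge_nth intro!: sum.cong)
  next
    case False
    then obtain l where l: "l \<in> K" "l \<notin> S" by blast
    have "pos_sign k K * vec_restrict S v $ k * mv_restrict S A $ (K - {k}) = 0" if "k \<in> K" for k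
      using l by (cases "k = l") (auto simp: mv_restrict_def vec_restrict_def)
    then have "(vec_restrict S v \<and>\<^sub>v mv_restrict S A) $ K = 0"
      unfolding vwedge_nth by (intro sum.neutral ballI)
    with False show ?thesis by (simp add: mv_restrict_def)
  qed
qed

lemma mv_restrict_wedge_list: "mv_restrict S (wedge_list vs) = wedge_list (map (vec_restrict S) vs)"
  by (induction vs) (simp_all add: mv_restrict_vwedge)

lemma cinner_mv_restrict: "cinner (mv_restrict S A) B = cinner A (mv_restrict S B)"
  unfolding cinner_def mv_restrict_def by (intro sum.cong) auto

lemma cinner_diff_right: "cinner x (y - z) = cinner x y - cinner x z"
  by (simp add: cinner_def algebra_simps sum_subtractf)

lemma norm_mv_restrict_le: "norm (mv_restrict S A) \<le> norm A"
  for A :: "('a::rc_field, 'n::finite) multivector"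
proof -
  have "norm (mv_restrict S A) ^ 2 \<le> norm A ^ 2"
    unfolding power2_norm_vec by (intro sum_mono) (auto simp: mv_restrict_def)
  then show ?thesis by (simp add: power2_le_iff_abs_le)
qed

lemma norm_vec_restrict_le: "norm (vec_restrict S x) \<le> norm x"
  for x :: "('a::rc_field, 'n::finite) coord_space"
proof -
  have "norm (vec_restrict S x) ^ 2 \<le> norm x ^ 2"
    unfolding power2_norm_vec by (intro sum_mono) (auto simp: vec_restrict_def)
  then show ?thesis by (simp add: power2_le_iff_abs_le)
qed

text \<open>By Pythagoras, the forgotten coordinates account for the whole difference of the squared norms.\<close>

lemma norm_mv_restrict_eq:
  fixes A :: "('a::rc_field, 'n::finite) multivector"
  assumes "norm (mv_restrict S A) = norm A"
  shows "mv_restrict S A = A"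
proof -
  have "norm A ^ 2 = norm (mv_restrict S A) ^ 2 + norm (A - mv_restrict S A) ^ 2"
    unfolding power2_norm_vec sum.distrib[symmetric]
    by (intro sum.cong) (auto simp: mv_restrict_def)
  with assms show ?thesis by simp
qed

text \<open>If \<open>A\<close> has only coordinates \<open>K \<subseteq> S\<close>, then \<open>T'\<close> exhibits it as a combination of products of the
  adapted basis vectors, which lie in \<open>W\<close>.\<close>

lemma mem_exterior_subalgebra_frame:
  fixes g :: "('a::rc_field, 'n::{finite,linorder}) vec_form"
  assumes "adapted_frame g W T T' S"
  shows "A \<in> exterior_subalgebra W \<longleftrightarrow> mv_restrict S (ext_map T A) = ext_map T A"
proof
  have frame: "frame g T T'" and W: "\<And>x. x \<in> W \<longleftrightarrow> (\<forall>k. k \<notin> S \<longrightarrow> (T *v x) $ k = 0)"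
    using assms by (auto simp: adapted_frame_def)
  {
    assume "A \<in> exterior_subalgebra W"
    then have "A \<in> vec.span {wedge_list ws | ws. set ws \<subseteq> W}"
      by (simp add: exterior_subalgebra_def)
    then show "mv_restrict S (ext_map T A) = ext_map T A"
    proof (induction rule: vec.span_induct_alt)
      case (step c B C)
      then obtain ws where "B = wedge_list ws" "set ws \<subseteq> W" by blast
      moreover have "vec_restrict S (T *v w) = T *v w" if "w \<in> W" for w
        using that W by (auto simp: vec_restrict_def coord_eq_iff)
      ultimately have "mv_restrict S (ext_map T B) = ext_map T B"
        by (auto simp: ext_map_wedge_list mv_restrict_wedge_list subset_iff comp_def intro!: arg_cong[of _ _ wedge_list])
      with step show ?case
        by (simp add: ext_map_add ext_map_scale mv_restrict_add mv_restrict_scale)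
    qed simp
  }
  assume *: "mv_restrict S (ext_map T A) = ext_map T A"
  have axis: "T' *v axis k 1 \<in> W" if "k \<in> S" for k
    using that W frame by (auto simp: frame_def axis_def)
  have "A = (\<Sum>K\<in>UNIV. ext_map T A $ K *s wedge_list (map ((*v) T') (basis_list K)))"
    using ext_map_frame_inverse(1)[OF frame, of A] by (simp add: ext_map_def[of T'])
  also have "\<dots> \<in> exterior_subalgebra W"
    unfolding exterior_subalgebra_def
  proof (rule vec.span_sum)
    fix K
    show "ext_map T A $ K *s wedge_list (map ((*v) T') (basis_list K)) \<in> vec.span {wedge_list ws | ws. set ws \<subseteq> W}"
    proof (cases "K \<subseteq> S")
      case True
      then have "set (map ((*v) T') (basis_list K)) \<subseteq> W" using axis by (auto simp: basis_list_def)
      then show ?thesis by (intro vec.span_scale vec.span_base) blast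
    next
      case False
      then have "mv_restrict S (ext_map T A) $ K = 0" by (simp add: mv_restrict_def)
      then have "ext_map T A $ K = 0" using * by simp
      then show ?thesis by (simp add: vec.span_zero)
    qed
  qed
  finally show "A \<in> exterior_subalgebra W" .
qed

text \<open>\<open>mv_restrict S\<close> is idempotent and self-adjoint for the standard form, and its range
  is the image of \<open>\<And>W\<close>. Definiteness of the form makes the projection unique.\<close>

lemma mv_proj_frame:
  fixes g :: "('a::rc_field, 'n::{finite,linorder}) vec_form"
  assumes ad: "adapted_frame g W T T' S"
  shows "ext_map T (mv_proj g W A) = mv_restrict S (ext_map T A)"
proof -
  have frame: "frame g T T'" using ad by (simp add: adapted_frame_def)
  note inv = ext_map_frame_inverse[OF frame]
  let ?B = "ext_map T' (mv_restrict S (ext_map T A))"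
  have "mv_proj g W A = ?B"
    unfolding mv_proj_def
  proof (rule the_equality, intro conjI ballI)
    show B: "?B \<in> exterior_subalgebra W"
      by (simp add: mem_exterior_subalgebra_frame[OF ad] inv)
    show orth: "mv_inner g C (A - ?B) = 0" if "C \<in> exterior_subalgebra W" for C
    proof -
      have "mv_inner g C (A - ?B) = cinner (mv_restrict S (ext_map T C)) (ext_map T A - mv_restrict S (ext_map T A))"
        using that by (simp add: mv_inner_frame[OF frame] ext_map_diff inv mem_exterior_subalgebra_frame[OF ad])
      also have "\<dots> = 0"
        by (simp only: cinner_mv_restrict mv_restrict_diff mv_restrict_idem) (simp add: cinner_def)
      finally show ?thesis .
    qed
    fix B' assume B': "B' \<in> exterior_subalgebra W \<and> (\<forall>C\<in>exterior_subalgebra W. mv_inner g C (A - B') = 0)"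
    define D where "D = ?B - B'"
    have "D \<in> exterior_subalgebra W"
      using B B' by (simp add: D_def mem_exterior_subalgebra_frame[OF ad] ext_map_diff mv_restrict_diff)
    then have "mv_inner g D (A - B') - mv_inner g D (A - ?B) = 0" using B' orth by simp
    then have "cinner (ext_map T D) (ext_map T D) = 0"
      by (simp add: mv_inner_frame[OF frame] D_def ext_map_diff cinner_diff_right)
    then have "ext_map T D = 0" by (simp add: cinner_self)
    then have "D = 0" using inv(1)[of D] by simp
    then show "B' = ?B" by (simp add: D_def)
  qed
  then show ?thesis by (simp add: inv)
qed

section \<open>Norms of exterior products\<close>

lemma norm_axis_one [simp]: "norm (axis k 1 :: 'a::rc_field ^ 'n::finite) = 1"
proof -
  have "norm (axis k 1 :: 'a ^ 'n) ^ 2 = (\<Sum>i\<in>UNIV. if i = k then 1 else 0)"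
    unfolding power2_norm_vec by (intro sum.cong) (auto simp: axis_def)
  then show ?thesis by (simp add: power2_eq_1_iff) (metis norm_ge_zero neg_0_le_iff_le not_one_le_zero)
qed

definition vec_norm :: "('a::rc_field, 'n::finite) vec_form \<Rightarrow> ('a, 'n) coord_space \<Rightarrow> real" where
  "vec_norm g x = sqrt (norm (g x x))"

lemma vec_norm_frame: "frame g T T' \<Longrightarrow> vec_norm g x = norm (T *v x)"
  by (simp add: vec_norm_def frame_def cinner_self norm_power flip: of_real_power)

lemma wedge_list_coordinate_zero:
  assumes "\<And>v. v \<in> set vs \<Longrightarrow> v $ k = 0" "k \<in> K"
  shows "wedge_list vs $ K = 0"
proof -
  have "map (vec_restrict (- {k})) vs = vs"
    using assms(1) by (auto simp: map_idI vec_restrict_def coord_eq_iff)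
  then have "wedge_list vs $ K = mv_restrict (- {k}) (wedge_list vs) $ K"
    by (simp add: mv_restrict_wedge_list)
  with assms(2) show ?thesis by (auto simp: mv_restrict_def)
qed

context
  fixes g :: "('a::rc_field, 'n::{finite,linorder}) vec_form"
  assumes g: "inner_product g"
begin

lemma frame_exists: obtains T T' where "frame g T T'"
proof -
  obtain T T' S where "adapted_frame g UNIV T T' S"
    using adapted_frame_exists[OF g vec.subspace_UNIV] .
  then show thesis by (intro that) (auto simp: adapted_frame_def)
qed

lemma mv_norm_zero_iff [simp]: "mv_norm g A = 0 \<longleftrightarrow> A = 0"
proof -
  obtain T T' where T: "frame g T T'" by (rule frame_exists)
  show ?thesis using ext_map_frame_inverse(1)[OF T, of A] by (auto simp: mv_norm_frame[OF T])
qed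

lemma mv_norm_zero [simp]: "mv_norm g 0 = 0"
  by simp

lemma mv_norm_nonneg [simp]: "0 \<le> mv_norm g A"
  by (simp add: mv_norm_def)

lemma mv_norm_scale: "mv_norm g (c *s A) = norm c * mv_norm g A"
proof -
  obtain T T' where T: "frame g T T'" by (rule frame_exists)
  show ?thesis by (simp add: mv_norm_frame[OF T] ext_map_scale norm_vector_scalar_mult)
qed

lemma vec_norm_pos: "x \<noteq> 0 \<Longrightarrow> 0 < vec_norm g x"
  using form_positive[OF g, of x] by (auto simp: vec_norm_def)

text \<open>In a frame adapted to the line through \<open>w\<close>, only one coordinate of \<open>w\<close> can be nonzero: for an
  index \<open>k\<close> where it does not vanish, the \<open>k\<close>-th basis vector lies on the line and so is
  proportional to \<open>w\<close>.\<close>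

lemma frame_along_vector:
  assumes "w \<noteq> 0"
  obtains T T' k c where "frame g T T'" "T *v w = c *s axis k 1" "c \<noteq> 0"
proof -
  obtain T T' S where ad: "adapted_frame g (vec.span {w}) T T' S"
    using adapted_frame_exists[OF g vec.subspace_span] by blast
  then have T: "frame g T T'"
    and line: "\<And>x. x \<in> vec.span {w} \<longleftrightarrow> (\<forall>k. k \<notin> S \<longrightarrow> (T *v x) $ k = 0)"
    by (auto simp: adapted_frame_def)
  have "T *v w \<noteq> 0" using T assms by (metis frame_def matrix_vector_mult_0_right)
  then obtain k where k: "(T *v w) $ k \<noteq> 0" by (auto simp: coord_eq_iff)
  then have "k \<in> S" using line[of w] vec.span_base[of w "{w}"] by auto
  then have "T' *v axis k 1 \<in> vec.span {w}" using line T by (auto simp: frame_def axis_def)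
  then obtain d where d: "T' *v axis k 1 = d *s w" by (auto simp: vec.span_singleton)
  have "axis k 1 = T *v (d *s w)" using T d by (metis frame_def)
  also have "\<dots> = d *s (T *v w)" by (simp add: vector_scalar_commute)
  finally have axis: "axis k 1 = d *s (T *v w)" .
  then have "d \<noteq> 0" by (auto simp: axis_eq_0_iff)
  then have "T *v w = inverse d *s axis k 1" by (simp add: axis vector_smult_assoc)
  with T \<open>d \<noteq> 0\<close> show thesis by (intro that[of T T' "inverse d" k]) auto
qed

text \<open>For \<open>w\<close> proportional to the first vector of an orthonormal basis this is a matter of coordinates
  (\<open>norm_axis_vwedge\<close>), and a frame along \<open>w\<close> reduces the general case to it.\<close>

lemma mv_norm_vwedge_le: "mv_norm g (w \<and>\<^sub>v A) \<le> vec_norm g w * mv_norm g A"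
proof (cases "w = 0")
  case True
  then have "mv_norm g (w \<and>\<^sub>v A) = 0" by simp
  then show ?thesis by (simp add: vec_norm_def)
next
  case False
  then obtain T T' k c where T: "frame g T T'" "T *v w = c *s axis k 1" by (rule frame_along_vector)
  have "mv_norm g (w \<and>\<^sub>v A) = norm c * norm (axis k 1 \<and>\<^sub>v ext_map T A)"
    by (simp add: mv_norm_frame[OF T(1)] ext_map_vwedge T(2) vwedge_scale_left norm_vector_scalar_mult)
  also have "\<dots> \<le> norm c * norm (ext_map T A)"
    by (intro mult_left_mono norm_axis_vwedge) simp
  finally show ?thesis
    by (simp add: mv_norm_frame[OF T(1)] vec_norm_frame[OF T(1)] T(2) norm_vector_scalar_mult)
qed

text \<open>In a frame along \<open>w\<close> the vectors of \<open>ds\<close> have no component in the direction of \<open>w\<close>, so no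
  coordinate of their product is killed by the factor \<open>w\<close>.\<close>

lemma mv_norm_vwedge_orthogonal:
  assumes orth: "\<And>d. d \<in> set ds \<Longrightarrow> g w d = 0"
  shows "mv_norm g (w \<and>\<^sub>v wedge_list ds) = vec_norm g w * mv_norm g (wedge_list ds)"
proof (cases "w = 0")
  case True
  then have "mv_norm g (w \<and>\<^sub>v wedge_list ds) = 0" by simp
  then show ?thesis using True form_zero_right[OF g] by (simp add: vec_norm_def)
next
  case False
  then obtain T T' k c where T: "frame g T T'" "T *v w = c *s axis k 1" "c \<noteq> 0"
    by (rule frame_along_vector)
  have "(T *v d) $ k = 0" if "d \<in> set ds" for d
  proof -
    have "0 = cinner (c *s axis k 1) (T *v d)" using orth[OF that] T by (simp add: frame_def)
    also have "\<dots> = conjugate c * (T *v d) $ k"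
      by (simp add: cinner_def axis_def if_distrib if_distribR cong: if_cong)
    finally show ?thesis using T(3) by simp
  qed
  then have "ext_map T (wedge_list ds) $ K = 0" if "k \<in> K" for K
    unfolding ext_map_wedge_list by (intro wedge_list_coordinate_zero[OF _ that]) auto
  then have "norm (axis k 1 \<and>\<^sub>v ext_map T (wedge_list ds)) = norm (ext_map T (wedge_list ds))"
    by (rule norm_axis_vwedge(2))
  then show ?thesis
    by (simp add: mv_norm_frame[OF T(1)] vec_norm_frame[OF T(1)] ext_map_vwedge T(2)
        vwedge_scale_left norm_vector_scalar_mult)
qed

lemma mv_proj_scale:
  assumes "vec.subspace W"
  shows "mv_proj g W (c *s A) = c *s mv_proj g W A"
proof -
  obtain T T' S where ad: "adapted_frame g W T T' S" using adapted_frame_exists[OF g assms] .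
  then have T: "frame g T T'" by (simp add: adapted_frame_def)
  have "ext_map T (mv_proj g W (c *s A)) = ext_map T (c *s mv_proj g W A)"
    by (simp add: mv_proj_frame[OF ad] ext_map_scale mv_restrict_scale)
  then show ?thesis by (metis ext_map_frame_inverse(1)[OF T])
qed

lemma mv_norm_proj_le:
  assumes "vec.subspace W"
  shows "mv_norm g (mv_proj g W A) \<le> mv_norm g A"
proof -
  obtain T T' S where ad: "adapted_frame g W T T' S" using adapted_frame_exists[OF g assms] .
  then have T: "frame g T T'" by (simp add: adapted_frame_def)
  show ?thesis by (simp add: mv_norm_frame[OF T] mv_proj_frame[OF ad] norm_mv_restrict_le)
qed

lemma mv_norm_proj_eq_iff:
  assumes "vec.subspace W"
  shows "mv_norm g (mv_proj g W A) = mv_norm g A \<longleftrightarrow> A \<in> exterior_subalgebra W"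
proof -
  obtain T T' S where ad: "adapted_frame g W T T' S" using adapted_frame_exists[OF g assms] .
  then have T: "frame g T T'" by (simp add: adapted_frame_def)
  show ?thesis
    by (auto simp: mv_norm_frame[OF T] mv_proj_frame[OF ad] mem_exterior_subalgebra_frame[OF ad]
        norm_mv_restrict_eq)
qed

text \<open>The first three properties describe the orthogonal projection of vectors to \<open>W\<close>; the last two say
  that the projection of multivectors is the algebra homomorphism which it induces.\<close>

lemma orthogonal_projection:
  assumes "vec.subspace W"
  obtains P where "\<And>x. P x \<in> W" "\<And>x y. y \<in> W \<Longrightarrow> g (x - P x) y = 0"
    "\<And>x. vec_norm g (P x) \<le> vec_norm g x"
    "\<And>x A. mv_proj g W (x \<and>\<^sub>v A) = P x \<and>\<^sub>v mv_proj g W A"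
    "mv_proj g W (mv_scalar 1) = mv_scalar 1"
proof -
  obtain T T' S where ad: "adapted_frame g W T T' S" using adapted_frame_exists[OF g assms] .
  then have T: "frame g T T'"
    and W: "\<And>x. x \<in> W \<longleftrightarrow> (\<forall>k. k \<notin> S \<longrightarrow> (T *v x) $ k = 0)"
    by (auto simp: adapted_frame_def)
  define P where "P x = T' *v vec_restrict S (T *v x)" for x
  have TP: "T *v P x = vec_restrict S (T *v x)" for x
    using T by (simp add: P_def frame_def)
  note inv = ext_map_frame_inverse(1)[OF T]
  show thesis
  proof (rule that[of P])
    show "P x \<in> W" for x by (simp add: W TP vec_restrict_def)
    show "g (x - P x) y = 0" if "y \<in> W" for x y
    proof -
      have "g (x - P x) y = cinner (T *v x - vec_restrict S (T *v x)) (T *v y)"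
        using T by (simp add: frame_def matrix_vector_mult_diff_distrib TP)
      also have "\<dots> = 0"
        using that unfolding cinner_def W by (intro sum.neutral) (auto simp: vec_restrict_def)
      finally show ?thesis .
    qed
    show "vec_norm g (P x) \<le> vec_norm g x" for x
      by (simp add: vec_norm_frame[OF T] TP norm_vec_restrict_le)
    show "mv_proj g W (x \<and>\<^sub>v A) = P x \<and>\<^sub>v mv_proj g W A" for x A
    proof -
      have "ext_map T (mv_proj g W (x \<and>\<^sub>v A)) = ext_map T (P x \<and>\<^sub>v mv_proj g W A)"
        by (simp add: mv_proj_frame[OF ad] ext_map_vwedge mv_restrict_vwedge TP)
      then show ?thesis by (metis inv)
    qed
    have "ext_map T (mv_proj g W (mv_scalar 1)) = ext_map T (mv_scalar 1)"
      by (simp add: mv_proj_frame[OF ad])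
    then show "mv_proj g W (mv_scalar 1) = mv_scalar 1" by (metis inv)
  qed
qed

lemma mv_proj_wedge_list:
  assumes "vec.subspace W"
  obtains us where "set us \<subseteq> W" "mv_proj g W (wedge_list vs) = wedge_list us"
proof -
  obtain P where P: "\<And>x. P x \<in> W" "\<And>x A. mv_proj g W (x \<and>\<^sub>v A) = P x \<and>\<^sub>v mv_proj g W A"
    "mv_proj g W (mv_scalar 1) = mv_scalar 1"
    using orthogonal_projection[OF assms] by metis
  have "mv_proj g W (wedge_list vs) = wedge_list (map P vs)"
    by (induction vs) (simp_all add: P)
  with P(1) show thesis by (intro that[of "map P vs"]) auto
qed

text \<open>The component of \<open>w\<close> in the span of \<open>ds\<close> contributes nothing to the product, so
  \<open>w\<close> may be replaced by its orthogonal component.\<close>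

lemma vwedge_orthogonal_part:
  fixes w :: "('a, 'n) coord_space"
  obtains w' where "w' - w \<in> vec.span (set ds)" "w' \<and>\<^sub>v wedge_list ds = w \<and>\<^sub>v wedge_list ds"
    "mv_norm g (w \<and>\<^sub>v wedge_list ds) = vec_norm g w' * mv_norm g (wedge_list ds)"
proof -
  obtain P where P: "\<And>x. P x \<in> vec.span (set ds)" "\<And>x y. y \<in> vec.span (set ds) \<Longrightarrow> g (x - P x) y = 0"
    using orthogonal_projection[OF vec.subspace_span] by metis
  have "w \<and>\<^sub>v wedge_list ds = ((w - P w) + P w) \<and>\<^sub>v wedge_list ds" by simp
  then have eq: "(w - P w) \<and>\<^sub>v wedge_list ds = w \<and>\<^sub>v wedge_list ds"
    by (simp only: vwedge_add_left vwedge_wedge_list_span[OF P(1)] add_0_right)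
  have "mv_norm g ((w - P w) \<and>\<^sub>v wedge_list ds) = vec_norm g (w - P w) * mv_norm g (wedge_list ds)"
    by (intro mv_norm_vwedge_orthogonal P(2) vec.span_base)
  with eq P(1) show thesis by (intro that[of "w - P w"]) (auto intro: vec.span_neg)
qed

lemma vwedge_wedge_list_nonzero:
  fixes w :: "('a, 'n) coord_space"
  assumes "wedge_list ds \<noteq> 0" "w \<notin> vec.span (set ds)"
  shows "w \<and>\<^sub>v wedge_list ds \<noteq> 0"
proof -
  obtain w' where w': "w' - w \<in> vec.span (set ds)"
    "mv_norm g (w \<and>\<^sub>v wedge_list ds) = vec_norm g w' * mv_norm g (wedge_list ds)"
    using vwedge_orthogonal_part by metis
  have "w' \<noteq> 0" using w'(1) assms(2) vec.span_neg[of "- w"] by auto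
  then show ?thesis using w'(2) assms(1) vec_norm_pos[of w'] mv_norm_zero_iff by (metis less_irrefl mult_eq_0_iff)
qed

text \<open>An additional factor does not increase the quotient \<open>\<parallel>P\<^sub>W D\<parallel> / \<parallel>D\<parallel>\<close>. The factor may be taken
  orthogonal to \<open>D\<close>; it then multiplies the denominator by \<open>\<parallel>w\<parallel>\<close> and the numerator by at most
  \<open>\<parallel>P\<^sub>W w\<parallel> \<le> \<parallel>w\<parallel>\<close>. The cleared denominators admit \<open>D = 0\<close>.\<close>

lemma mv_proj_vwedge_contraction:
  assumes W: "vec.subspace W"
  shows "mv_norm g (mv_proj g W (w \<and>\<^sub>v wedge_list ds)) * mv_norm g (wedge_list ds)
    \<le> mv_norm g (mv_proj g W (wedge_list ds)) * mv_norm g (w \<and>\<^sub>v wedge_list ds)"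
proof -
  obtain P where P: "\<And>x. vec_norm g (P x) \<le> vec_norm g x"
    "\<And>x A. mv_proj g W (x \<and>\<^sub>v A) = P x \<and>\<^sub>v mv_proj g W A"
    using orthogonal_projection[OF W] by metis
  obtain w' where w': "w' \<and>\<^sub>v wedge_list ds = w \<and>\<^sub>v wedge_list ds"
    "mv_norm g (w \<and>\<^sub>v wedge_list ds) = vec_norm g w' * mv_norm g (wedge_list ds)"
    using vwedge_orthogonal_part by metis
  have "mv_norm g (mv_proj g W (w \<and>\<^sub>v wedge_list ds)) \<le> vec_norm g (P w') * mv_norm g (mv_proj g W (wedge_list ds))"
    unfolding w'(1)[symmetric] P(2) by (rule mv_norm_vwedge_le)
  also have "\<dots> \<le> vec_norm g w' * mv_norm g (mv_proj g W (wedge_list ds))"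
    by (intro mult_right_mono P(1)) simp
  finally have "mv_norm g (mv_proj g W (w \<and>\<^sub>v wedge_list ds)) * mv_norm g (wedge_list ds)
      \<le> (vec_norm g w' * mv_norm g (mv_proj g W (wedge_list ds))) * mv_norm g (wedge_list ds)"
    by (intro mult_right_mono) simp_all
  then show ?thesis unfolding w'(2) by (simp only: mult_ac)
qed

lemma mv_proj_extension_contraction:
  assumes W: "vec.subspace W"
  shows "mv_norm g (mv_proj g W (wedge_list (ws @ us))) * mv_norm g (wedge_list us)
    \<le> mv_norm g (mv_proj g W (wedge_list us)) * mv_norm g (wedge_list (ws @ us))"
proof (induction ws)
  case (Cons w ws)
  define D where "D = wedge_list (ws @ us)"
  define p where "p A = mv_norm g (mv_proj g W A)" for A
  define n where "n = mv_norm g"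
  note defs = D_def p_def n_def
  show ?case
  proof (cases "D = 0")
    case True
    then have "wedge_list ((w # ws) @ us) = 0" by (simp add: D_def)
    then show ?thesis
      using mv_norm_proj_le[OF W, of 0] mv_norm_nonneg[of "mv_proj g W 0"] by simp
  next
    case False
    then have pos: "n D > 0" using mv_norm_zero_iff[of D] mv_norm_nonneg[of D] by (simp add: n_def less_le)
    have step: "p (w \<and>\<^sub>v D) * n D \<le> p D * n (w \<and>\<^sub>v D)"
      unfolding defs by (rule mv_proj_vwedge_contraction[OF W])
    have IH: "p D * n (wedge_list us) \<le> p (wedge_list us) * n D"
      using Cons.IH by (simp add: defs)
    have "p (w \<and>\<^sub>v D) * n (wedge_list us) * n D = (p (w \<and>\<^sub>v D) * n D) * n (wedge_list us)"
      by (simp only: mult_ac)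
    also have "\<dots> \<le> (p D * n (w \<and>\<^sub>v D)) * n (wedge_list us)"
      by (intro mult_right_mono step) (simp add: n_def)
    also have "\<dots> = (p D * n (wedge_list us)) * n (w \<and>\<^sub>v D)" by (simp only: mult_ac)
    also have "\<dots> \<le> (p (wedge_list us) * n D) * n (w \<and>\<^sub>v D)"
      by (intro mult_right_mono IH) (simp add: n_def)
    also have "\<dots> = (p (wedge_list us) * n (w \<and>\<^sub>v D)) * n D" by (simp only: mult_ac)
    finally show ?thesis using pos by (simp add: defs)
  qed
qed simp

text \<open>A nonzero product of vectors in \<open>V\<close> with the greatest number of factors has factors that span \<open>V\<close>,
  since any vector outside the span could be added. The number of factors is bounded because it is
  the grade.\<close>

lemma wedge_list_extend:
  fixes V :: "('a, 'n) coord_space set"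
  assumes V: "vec.subspace V" and us: "wedge_list us \<noteq> 0" "set us \<subseteq> V"
  obtains ws where "wedge_list (ws @ us) \<noteq> 0" "vec.span (set (ws @ us)) = V"
proof -
  let ?P = "\<lambda>ws. wedge_list (ws @ us) \<noteq> 0 \<and> set ws \<subseteq> V"
  have bound: "length ws < Suc CARD('n)" if P: "?P ws" for ws
  proof -
    obtain K where "wedge_list (ws @ us) $ K \<noteq> 0" using P by (auto simp: coord_eq_iff)
    then have "card K = length (ws @ us)" by (rule wedge_list_length)
    moreover have "card K \<le> CARD('n)" by (rule Finite_Set.card_mono) simp_all
    ultimately show ?thesis by simp
  qed
  have "?P []" using us by simp
  then obtain ws where ws: "?P ws" and maximal: "\<And>xs. ?P xs \<Longrightarrow> length xs \<le> length ws"
    using ex_has_greatest_nat[of ?P "[]" length "Suc CARD('n)"] bound by blast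
  have "V \<subseteq> vec.span (set (ws @ us))"
  proof (rule subsetI, rule ccontr)
    fix v assume "v \<in> V" "v \<notin> vec.span (set (ws @ us))"
    then have "?P (v # ws)" using ws vwedge_wedge_list_nonzero[of "ws @ us" v] by simp
    then show False using maximal[of "v # ws"] by simp
  qed
  moreover have "vec.span (set (ws @ us)) \<subseteq> V" using ws us V by (intro vec.span_minimal) auto
  ultimately show thesis using ws that by blast
qed

end

section \<open>The angle triangle inequality in an inner product space\<close>

text \<open>The assumption on \<open>R\<close> holds for every orthogonal projection, and the one on \<open>y\<close> says
  that \<open>y\<close> is an orthogonal projection of \<open>x\<close>. With the angles \<open>\<alpha> = arccos t\<close> from \<open>x\<close> to \<open>y\<close> and \<open>\<beta> = arccos s\<close>
  from \<open>y\<close> to the range of \<open>R\<close>, the claim amounts to \<open>cos (\<alpha> + \<beta>) \<le> \<parallel>R x\<parallel> / \<parallel>x\<parallel>\<close> unless \<open>\<alpha> + \<beta>\<close>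
  reaches a right angle. The length of \<open>R x\<close> is bounded from below by its component along \<open>R y\<close>.\<close>

lemma arccos_triangle_projection:
  fixes x y :: "'e::real_inner" and R :: "'e \<Rightarrow> 'e"
  assumes R: "\<And>u v. inner (R u) (R v) = inner u (R v)"
    and y: "inner y x = norm y ^ 2" and nz: "x \<noteq> 0" "y \<noteq> 0"
  shows "arccos (norm (R x) / norm x) \<le> arccos (norm y / norm x) + arccos (norm (R y) / norm y)"
proof -
  define c where "c = x - y"
  define s where "s = norm (R y) / norm y"
  define t where "t = norm y / norm x"
  have contract: "norm (R u) \<le> norm u" for u
  proof -
    have "norm (R u) * norm (R u) = inner u (R u)"
      using R[of u u] by (simp add: power2_norm_eq_inner flip: power2_eq_square)
    then have "norm (R u) * norm (R u) \<le> norm u * norm (R u)"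
      using norm_cauchy_schwarz[of u "R u"] by simp
    then show ?thesis
      by (cases "norm (R u) = 0") (simp_all only: mult_le_cancel_right, auto)
  qed
  have "norm y * norm y \<le> norm y * norm x"
    using norm_cauchy_schwarz[of y x] y by (simp add: power2_eq_square)
  then have yx: "norm y \<le> norm x" using nz by simp
  have t: "0 \<le> t" "t \<le> 1" and s: "0 \<le> s" "s \<le> 1"
    using yx contract[of y] nz by (simp_all add: t_def s_def)
  have Rx: "0 \<le> norm (R x) / norm x" "norm (R x) / norm x \<le> 1"
    using contract[of x] nz by simp_all
  have c: "inner c y = 0" "norm c ^ 2 = norm x ^ 2 - norm y ^ 2"
    using y by (simp_all add: c_def power2_norm_eq_inner inner_diff_left inner_diff_right inner_commute)
  have norm_c: "norm c = norm x * sqrt (1 - t ^ 2)"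
  proof -
    have "norm x ^ 2 * t ^ 2 = norm y ^ 2" using nz by (simp add: t_def power_divide)
    then have "norm c ^ 2 = norm x ^ 2 * (1 - t ^ 2)"
      using c(2) by (simp add: algebra_simps)
    then show ?thesis by (metis norm_ge_zero real_sqrt_abs abs_norm_cancel real_sqrt_mult)
  qed
  have inner_Ry: "inner y (R y) = norm (R y) ^ 2"
    using R[of y y] by (simp add: power2_norm_eq_inner)
  \<comment> \<open>\<open>R y\<close> splits into \<open>s\<^sup>2 y\<close> and a part orthogonal to \<open>y\<close>; only that part meets \<open>c\<close>.\<close>
  define e where "e = R y - s ^ 2 *\<^sub>R y"
  have norm_e: "norm e = norm (R y) * sqrt (1 - s ^ 2)"
  proof -
    have "norm e ^ 2 = norm (R y) ^ 2 - 2 * s ^ 2 * norm (R y) ^ 2 + s ^ 4 * norm y ^ 2"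
      unfolding e_def power2_norm_eq_inner
      by (simp add: inner_diff_left inner_diff_right inner_commute inner_Ry[unfolded power2_norm_eq_inner]
          algebra_simps power2_eq_square power4_eq_xxxx)
    also have "\<dots> = norm (R y) ^ 2 * (1 - s ^ 2)"
      using nz by (simp add: s_def power_divide field_simps power2_eq_square power4_eq_xxxx)
    finally show ?thesis by (metis norm_ge_zero real_sqrt_abs abs_norm_cancel real_sqrt_mult)
  qed
  have "inner c (R y) = inner c e"
    using c(1) by (simp add: e_def inner_diff_right)
  then have "- (norm c * norm e) \<le> inner c (R y)"
    using Cauchy_Schwarz_ineq2[of c e] by simp
  moreover have "inner (R x) (R y) = norm (R y) ^ 2 + inner c (R y)"
    using R[of x y] inner_Ry by (simp add: c_def inner_diff_left)
  moreover have "inner (R x) (R y) \<le> norm (R x) * norm (R y)" by (rule norm_cauchy_schwarz)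
  ultimately have key: "norm (R y) * (norm (R y) - norm c * sqrt (1 - s ^ 2)) \<le> norm (R y) * norm (R x)"
    by (simp add: norm_e algebra_simps power2_eq_square)
  show ?thesis
  proof (cases "pi / 2 \<le> arccos t + arccos s")
    case True
    moreover have "arccos (norm (R x) / norm x) \<le> pi / 2" using Rx by (intro arccos_le_pi2) auto
    ultimately show ?thesis by (simp add: t_def s_def)
  next
    case False
    have ge0: "0 \<le> arccos t" "0 \<le> arccos s" using t s by (auto intro: arccos_lbound)
    have "s \<noteq> 0" using False ge0 by auto
    then have "norm (R y) > 0" using nz by (simp add: s_def)
    with key have "norm (R y) - norm c * sqrt (1 - s ^ 2) \<le> norm (R x)" by simp
    then have "(norm (R y) - norm c * sqrt (1 - s ^ 2)) / norm x \<le> norm (R x) / norm x"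
      by (rule divide_right_mono) simp
    moreover have "(norm (R y) - norm c * sqrt (1 - s ^ 2)) / norm x = t * s - sqrt (1 - t ^ 2) * sqrt (1 - s ^ 2)"
      using nz by (simp add: norm_c diff_divide_distrib) (simp add: t_def s_def)
    moreover have "cos (arccos t + arccos s) = t * s - sqrt (1 - t ^ 2) * sqrt (1 - s ^ 2)"
      using t s by (simp add: cos_add sin_arccos)
    ultimately have "cos (arccos t + arccos s) \<le> norm (R x) / norm x" by simp
    then have "arccos (norm (R x) / norm x) \<le> arccos (cos (arccos t + arccos s))"
      using Rx by (intro arccos_le_arccos) auto
    also have "\<dots> = arccos t + arccos s"
      using False ge0 pi_gt_zero by (intro arccos_cos) linarith+
    finally show ?thesis by (simp add: t_def s_def)
  qed
qed

section \<open>Blades and the subspaces that they represent\<close>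

text \<open>Scalars become multiples of the empty product, so the two cases of the definition need not be
  distinguished any further.\<close>

lemma representsD:
  assumes "represents A V"
  obtains c vs where "c \<noteq> 0" "A = c *s wedge_list vs" "wedge_list vs \<noteq> 0" "V = vec.span (set vs)"
proof -
  have A: "A \<noteq> 0" using assms by (simp add: represents_def)
  from assms consider vs where "A = wedge_list vs" "V = vec.span (set vs)" | c where "A = mv_scalar c" "V = {0}"
    unfolding represents_def by blast
  then show thesis
  proof cases
    case 1
    with A show thesis by (intro that[of 1 vs]) auto
  next
    case 2
    have "mv_scalar c = c *s wedge_list []" by (auto simp: mv_scalar_def coord_eq_iff)
    with 2 A show thesis by (intro that[of c "[]"]) auto
  qed
qed

lemma represents_wedge_list: "wedge_list vs \<noteq> 0 \<Longrightarrow> represents (wedge_list vs) (vec.span (set vs))"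
  by (cases "vs = []") (auto simp: represents_def)

lemma wedge_list_nonzero_independent:
  fixes vs :: "('a::real_normed_field, 'n::{finite,linorder}) coord_space list"
  assumes "wedge_list vs \<noteq> 0"
  shows "distinct vs \<and> vec.independent (set vs)"
  using assms
proof (induction vs)
  case (Cons v vs)
  then have "v \<notin> vec.span (set vs)" "wedge_list vs \<noteq> 0"
    using vwedge_wedge_list_span[of v vs] by auto
  with Cons show ?case by (auto simp: vec.independent_insert intro: vec.span_base)
qed (simp add: vec.independent_empty)

text \<open>In coordinates adapted to \<open>W\<close>: if \<open>v\<close> had a component in a direction \<open>k \<notin> S\<close>, then for every
  nonzero coordinate \<open>K\<close> of \<open>A\<close> the coordinate \<open>insert k K\<close> of the product would be that component
  times the coordinate \<open>K\<close>, up to sign.\<close>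

lemma mem_subspace_of_vwedge_zero:
  fixes g :: "('a::rc_field, 'n::{finite,linorder}) vec_form"
    and W :: "('a, 'n) coord_space set"
  assumes g: "inner_product g" and W: "vec.subspace W"
    and A: "A \<in> exterior_subalgebra W" "A \<noteq> 0" and v: "v \<and>\<^sub>v A = 0"
  shows "v \<in> W"
proof -
  obtain T T' S where ad: "adapted_frame g W T T' S" using adapted_frame_exists[OF g W] .
  then have T: "frame g T T'" and mem: "v \<in> W \<longleftrightarrow> (\<forall>k. k \<notin> S \<longrightarrow> (T *v v) $ k = 0)"
    by (auto simp: adapted_frame_def)
  define B where "B = ext_map T A"
  have B: "mv_restrict S B = B" using A(1) by (simp add: B_def mem_exterior_subalgebra_frame[OF ad])
  have supp: "B $ K = 0" if "\<not> K \<subseteq> S" for K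
  proof -
    have "mv_restrict S B $ K = 0" using that by (simp add: mv_restrict_def)
    then show ?thesis by (simp add: B)
  qed
  have "B \<noteq> 0" using A(2) ext_map_frame_inverse(1)[OF T, of A] by (auto simp: B_def)
  then obtain K where K: "B $ K \<noteq> 0" by (auto simp: coord_eq_iff)
  then have "K \<subseteq> S" using supp by blast
  have "(T *v v) $ k = 0" if "k \<notin> S" for k
  proof -
    have "k \<notin> K" using that \<open>K \<subseteq> S\<close> by blast
    \<comment> \<open>removing any index other than \<open>k\<close> from \<open>insert k K\<close> leaves a set outside \<open>S\<close>\<close>
    have "((T *v v) \<and>\<^sub>v B) $ insert k K =
      (\<Sum>l\<in>insert k K. if l = k then pos_sign k (insert k K) * (T *v v) $ k * B $ K else 0)"
      unfolding vwedge_nth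
    proof (rule sum.cong)
      fix l assume "l \<in> insert k K"
      show "pos_sign l (insert k K) * (T *v v) $ l * B $ (insert k K - {l}) =
        (if l = k then pos_sign k (insert k K) * (T *v v) $ k * B $ K else 0)"
        using supp[of "insert k K - {l}"] that \<open>k \<notin> K\<close> by (cases "l = k") auto
    qed simp
    moreover have "(T *v v) \<and>\<^sub>v B = 0"
      using ext_map_vwedge[of T v A] v by (simp add: B_def)
    ultimately have "pos_sign k (insert k K) * (T *v v) $ k * B $ K = 0" by simp
    with K show ?thesis by (simp add: pos_sign_def)
  qed
  with mem show ?thesis by blast
qed

definition cos_ratio :: "('a::rc_field, 'n::{finite,linorder}) vec_form \<Rightarrow>
    ('a, 'n) coord_space set \<Rightarrow> ('a, 'n) multivector \<Rightarrow> real" where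
  "cos_ratio g W A = mv_norm g (mv_proj g W A) / mv_norm g A"

context
  fixes g :: "('a::rc_field, 'n::{finite,linorder}) vec_form"
  assumes g: "inner_product g"
begin

text \<open>In coordinates adapted to \<open>V\<close>, a blade representing \<open>V\<close> has only coordinates \<open>K \<subseteq> S\<close> with
  \<open>card K\<close> equal to the number of its factors. This number is at least \<open>card S\<close>, the dimension of \<open>V\<close>, so
  only \<open>K = S\<close> remains.\<close>

lemma represents_unique:
  fixes V :: "('a, 'n) coord_space set"
  assumes V: "vec.subspace V"
  obtains B where "\<And>A. represents A V \<Longrightarrow> \<exists>c. c \<noteq> 0 \<and> A = c *s B"
proof -
  obtain T T' S where ad: "adapted_frame g V T T' S" using adapted_frame_exists[OF g V] .
  then have T: "frame g T T'" and mem: "\<And>v. v \<in> V \<longleftrightarrow> (\<forall>k. k \<notin> S \<longrightarrow> (T *v v) $ k = 0)"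
    by (auto simp: adapted_frame_def)
  note inv = ext_map_frame_inverse[OF T]
  define bs where "bs = map ((*v) T') (basis_list S)"
  have bs_V: "set bs \<subseteq> V" 
    using T by (auto simp: bs_def basis_list_def mem frame_def axis_def)
  have wedge_bs: "wedge_list bs = ext_map T' (axis S 1)" by (simp add: bs_def ext_map_axis)
  have "wedge_list bs \<noteq> 0"
    using inv(2)[of "axis S 1"] by (auto simp: wedge_bs axis_eq_0_iff)
  then have bs: "distinct bs" "vec.independent (set bs)"
    using wedge_list_nonzero_independent by blast+
  have "\<exists>c. c \<noteq> 0 \<and> wedge_list vs = c *s wedge_list bs"
    if vs: "wedge_list vs \<noteq> 0" "V = vec.span (set vs)" for vs
  proof -
    have "card (set bs) \<le> card (set vs)"
      using vec.independent_span_bound[of "set vs" "set bs"] bs bs_V vs(2) by simp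
    moreover have "card (set bs) = card S"
      using distinct_card[OF bs(1)] by (simp add: bs_def basis_list_def)
    ultimately have "card S \<le> length vs"
      using card_length[of vs] by linarith
    have supp: "K = S" if K: "ext_map T (wedge_list vs) $ K \<noteq> 0" for K
    proof -
      have "wedge_list vs \<in> exterior_subalgebra V"
        unfolding exterior_subalgebra_def vs(2) by (intro vec.span_base) (auto intro: vec.span_base)
      then have "mv_restrict S (ext_map T (wedge_list vs)) $ K \<noteq> 0"
        using K by (simp add: mem_exterior_subalgebra_frame[OF ad])
      then have "K \<subseteq> S" by (auto simp: mv_restrict_def split: if_splits)
      moreover have "card K = length vs"
        using K wedge_list_length by (fastforce simp: ext_map_wedge_list)
      ultimately show ?thesis using \<open>card S \<le> length vs\<close> by (intro card_seteq) auto
    qed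
    define c where "c = ext_map T (wedge_list vs) $ S"
    have eq: "ext_map T (wedge_list vs) = c *s axis S 1"
      using supp by (auto simp: coord_eq_iff axis_def c_def)
    have "wedge_list vs = ext_map T' (ext_map T (wedge_list vs))" by (simp add: inv)
    also have "\<dots> = c *s wedge_list bs" by (simp only: eq ext_map_scale wedge_bs)
    finally show ?thesis using vs(1) by (intro exI[of _ c]) auto
  qed
  then show thesis
    by (intro that[of "wedge_list bs"])
      (metis representsD vector_smult_assoc mult_eq_0_iff)
qed

lemma represents_exists:
  fixes V :: "('a, 'n) coord_space set"
  assumes "vec.subspace V"
  obtains vs where "represents (wedge_list vs) V" "wedge_list vs \<noteq> 0" "vec.span (set vs) = V"
proof -
  have "wedge_list ([] :: ('a, 'n) coord_space list) \<noteq> 0"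
    by (auto simp: mv_scalar_def coord_eq_iff)
  then obtain vs where "wedge_list vs \<noteq> 0" "vec.span (set vs) = V"
    using wedge_list_extend[OF g assms, of "[]"] by auto
  with represents_wedge_list[of vs] show thesis by (intro that[of vs]) auto
qed

lemma cos_ratio_bounds:
  assumes "vec.subspace W"
  shows "0 \<le> cos_ratio g W A" "cos_ratio g W A \<le> 1"
  using mv_norm_proj_le[OF g assms, of A] mv_norm_nonneg[OF g, of A] mv_norm_nonneg[OF g, of "mv_proj g W A"]
  by (auto simp: cos_ratio_def intro: divide_le_eq_1[THEN iffD2])

section \<open>The asymmetric angle\<close>

text \<open>The description in the definition of the angle picks out a unique value, because blades representing
  \<open>V\<close> are proportional and \<open>cos_ratio g W\<close> does not change under nonzero scaling.\<close>

lemma asym_angle_represents: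
  fixes V :: "('a, 'n) coord_space set"
  assumes V: "vec.subspace V" and W: "vec.subspace W" and A: "represents A V"
  shows "asym_angle g V W = arccos (cos_ratio g W A)"
proof -
  obtain B where B: "\<And>A. represents A V \<Longrightarrow> \<exists>c. c \<noteq> 0 \<and> A = c *s B"
    using represents_unique[OF V] by metis
  have ratio: "cos_ratio g W A = cos_ratio g W B" if A: "represents A V" for A
  proof -
    obtain c where "c \<noteq> 0" "A = c *s B" using B[OF A] by blast
    then show ?thesis by (simp add: cos_ratio_def mv_proj_scale[OF g W] mv_norm_scale[OF g])
  qed
  show ?thesis
    unfolding asym_angle_def cos_ratio_def[symmetric]
    using A ratio by (intro the_equality) auto
qed

lemma asym_angle_bounds:
  fixes V :: "('a, 'n) coord_space set"
  assumes V: "vec.subspace V" and W: "vec.subspace W"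
  shows "0 \<le> asym_angle g V W" "asym_angle g V W \<le> pi / 2"
proof -
  obtain vs where "represents (wedge_list vs) V" using represents_exists[OF V] .
  then have "asym_angle g V W = arccos (cos_ratio g W (wedge_list vs))"
    by (rule asym_angle_represents[OF V W])
  then show "0 \<le> asym_angle g V W" "asym_angle g V W \<le> pi / 2"
    using cos_ratio_bounds[OF W, of "wedge_list vs"] by (simp_all only: arccos_lbound arccos_le_pi2)
qed

lemma asym_angle_zero_iff:
  fixes V :: "('a, 'n) coord_space set"
  assumes V: "vec.subspace V" and W: "vec.subspace W"
  shows "asym_angle g V W = 0 \<longleftrightarrow> V \<subseteq> W"
proof -
  obtain vs where vs: "represents (wedge_list vs) V" "wedge_list vs \<noteq> 0" "vec.span (set vs) = V"
    using represents_exists[OF V] .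
  have "asym_angle g V W = 0 \<longleftrightarrow> cos_ratio g W (wedge_list vs) = 1"
    unfolding asym_angle_represents[OF V W vs(1)]
    using cos_ratio_bounds[OF W, of "wedge_list vs"]
    by (metis arccos_1 cos_arccos cos_zero neg_le_0_iff_le order_trans zero_le_one)
  also have "\<dots> \<longleftrightarrow> mv_norm g (mv_proj g W (wedge_list vs)) = mv_norm g (wedge_list vs)"
    using vs(2) mv_norm_zero_iff[OF g, of "wedge_list vs"] by (auto simp: cos_ratio_def)
  also have "\<dots> \<longleftrightarrow> wedge_list vs \<in> exterior_subalgebra W"
    by (rule mv_norm_proj_eq_iff[OF g W])
  also have "\<dots> \<longleftrightarrow> V \<subseteq> W"
  proof
    assume "wedge_list vs \<in> exterior_subalgebra W"
    then show "V \<subseteq> W"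
      using mem_subspace_of_vwedge_zero[OF g W _ vs(2)] vwedge_wedge_list_span[of _ vs] vs(3) by blast
  next
    assume "V \<subseteq> W"
    then have "set vs \<subseteq> W" using vs(3) vec.span_superset by blast
    then show "wedge_list vs \<in> exterior_subalgebra W"
      unfolding exterior_subalgebra_def by (intro vec.span_base) blast
  qed
  finally show ?thesis .
qed

lemma asym_angle_triangle:
  assumes U: "vec.subspace U" and V: "vec.subspace V" and W: "vec.subspace W"
  shows "asym_angle g U W \<le> asym_angle g U V + asym_angle g V W"
proof -
  obtain us where us: "represents (wedge_list us) U" "wedge_list us \<noteq> 0"
    using represents_exists[OF U] .
  define A where "A = wedge_list us"
  define B where "B = mv_proj g V A"
  have UV: "asym_angle g U V = arccos (cos_ratio g V A)"
    unfolding A_def by (rule asym_angle_represents[OF U V us(1)])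
  have UW: "asym_angle g U W = arccos (cos_ratio g W A)"
    unfolding A_def by (rule asym_angle_represents[OF U W us(1)])
  show ?thesis
  proof (cases "B = 0")
    case True
    then have "asym_angle g U V = pi / 2"
      using UV mv_norm_zero[OF g] by (simp add: cos_ratio_def B_def)
    then show ?thesis using asym_angle_bounds[OF U W] asym_angle_bounds[OF V W] by simp
  next
    case False
    obtain bs where bs: "set bs \<subseteq> V" "B = wedge_list bs"
      unfolding B_def A_def using mv_proj_wedge_list[OF g V] by metis
    obtain ws where ws: "wedge_list (ws @ bs) \<noteq> 0" "vec.span (set (ws @ bs)) = V"
      using wedge_list_extend[OF g V _ bs(1)] False bs(2) by metis
    \<comment> \<open>\<open>C\<close> represents \<open>V\<close> and prolongs \<open>B\<close>, which represents a subspace of \<open>V\<close>.\<close>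
    define C where "C = wedge_list (ws @ bs)"
    have "represents C V"
      using represents_wedge_list[OF ws(1)] ws(2) by (simp add: C_def)
    then have VW: "asym_angle g V W = arccos (cos_ratio g W C)"
      by (rule asym_angle_represents[OF V W])
    have pos: "mv_norm g B > 0" "mv_norm g C > 0" "A \<noteq> 0"
      using False ws(1) us(2) mv_norm_zero_iff[OF g] mv_norm_nonneg[OF g] 
      by (auto simp: C_def A_def less_le)
    have "cos_ratio g W C \<le> cos_ratio g W B"
      using mv_proj_extension_contraction[OF g W, of ws bs] pos
      by (simp add: cos_ratio_def C_def bs(2) divide_simps mult_ac)
    then have "arccos (cos_ratio g W B) \<le> asym_angle g V W"
      unfolding VW using cos_ratio_bounds[OF W, of C] cos_ratio_bounds[OF W, of B]
      by (intro arccos_le_arccos) auto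
    moreover have "arccos (cos_ratio g W A) \<le> arccos (cos_ratio g V A) + arccos (cos_ratio g W B)"
    proof -
      obtain T T' S where ad: "adapted_frame g W T T' S" using adapted_frame_exists[OF g W] .
      then have T: "frame g T T'" by (simp add: adapted_frame_def)
      \<comment> \<open>That \<open>B\<close> is the projection of \<open>A\<close> to \<open>\<And>V\<close> is seen in a frame adapted to \<open>V\<close>, the norms in one adapted to \<open>W\<close>.\<close>
      obtain Q Q' Z where adV: "adapted_frame g V Q Q' Z" using adapted_frame_exists[OF g V] .
      then have Q: "frame g Q Q'" by (simp add: adapted_frame_def)
      have R: "inner (mv_restrict S X) (mv_restrict S Y) = inner X (mv_restrict S Y)" for X Y :: "('a, 'n) multivector"
        by (simp add: inner_eq_cinner cinner_mv_restrict)
      have "inner (ext_map T B) (ext_map T A) = inner 1 (mv_inner g B A)"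
        by (simp add: inner_eq_cinner[of "ext_map T B"] mv_inner_frame[OF T])
      also have "mv_inner g B A = mv_inner g B B"
      proof -
        have "mv_restrict Z (ext_map Q B) = ext_map Q B"
          by (simp add: B_def mv_proj_frame[OF adV])
        then show ?thesis
          by (metis B_def cinner_mv_restrict mv_inner_frame[OF Q] mv_proj_frame[OF adV])
      qed
      also have "inner 1 (mv_inner g B B) = norm (ext_map T B) ^ 2"
        by (simp add: mv_inner_frame[OF T] power2_norm_eq_inner inner_eq_cinner[of "ext_map T B"])
      finally have "inner (ext_map T B) (ext_map T A) = norm (ext_map T B) ^ 2" .
      moreover have "ext_map T X \<noteq> 0" if "X \<noteq> 0" for X
        using that ext_map_frame_inverse(1)[OF T, of X] by auto
      ultimately have "arccos (norm (mv_restrict S (ext_map T A)) / norm (ext_map T A))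
        \<le> arccos (norm (ext_map T B) / norm (ext_map T A))
          + arccos (norm (mv_restrict S (ext_map T B)) / norm (ext_map T B))"
        using False pos(3) by (intro arccos_triangle_projection R) auto
      then show ?thesis
        by (simp add: cos_ratio_def mv_norm_frame[OF T] mv_proj_frame[OF ad] B_def)
    qed
    ultimately show ?thesis using UV UW by simp
  qed
qed

lemma asym_angle_metric: "asymmetric_metric_on full_grassmannian (\<lambda>V W. ereal (asym_angle g V W))"
  unfolding asymmetric_metric_on_def
proof (intro conjI ballI)
  have "{0} \<in> (full_grassmannian :: ('a, 'n) coord_space set set)"
    by (simp add: full_grassmannian_def vec.subspace_single_0)
  then show "full_grassmannian \<noteq> ({} :: ('a, 'n) coord_space set set)" by blast
qed (auto simp: full_grassmannian_def asym_angle_bounds asym_angle_zero_iff asym_angle_triangle)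

end

theorem theorem3p16:
  fixes g\<^sub>R :: "(real, 'n::{finite,linorder}) vec_form"
    and g\<^sub>C :: "(complex, 'n) vec_form"
  shows "(inner_product g\<^sub>R \<longrightarrow>
            asymmetric_metric_on full_grassmannian (\<lambda>V W. ereal (asym_angle g\<^sub>R V W))) \<and>
         (inner_product g\<^sub>C \<longrightarrow>
            asymmetric_metric_on full_grassmannian (\<lambda>V W. ereal (asym_angle g\<^sub>C V W)))"
  using asym_angle_metric[of g\<^sub>R] asym_angle_metric[of g\<^sub>C] by blast

end
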